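(* Let $r,q,a\in\mathbb{R}$, $\sigma>0$, $b>0$, $0\le R<1$, $0<T_1<T$, $V_b(t)=be^{-a(T-t)}$, and let $B(V,t)$ be the function \[ B(V,t)=Re^{-r(T-t)}+(1-R)e^{-r(T-t)}\left[N(d_1)-\left(\frac{V}{be^{-a(T-t)}}\right)^{1-\frac{2(r-q-a)}{\sigma^2}}N(d_2)\right], \] \[ d_1=\frac{\ln\frac{V}{b}+(r-q-\frac{\sigma^2}{2})(T-t)}{\sigma\sqrt{T-t}},\qquad d_2=\frac{\ln\frac{b}{V}+(r-q-2a-\frac{\sigma^2}{2})(T-t)}{\sigma\sqrt{T-t}}. \] Assume $e^{-r(T-T_1)}R<E<e^{-r(T-T_1)}$, and let $K\ge V_b(T_1)$ be the unique number such that $B(V,T_1)<E$ for $V<K$ and $B(V,T_1)\ge E$ for $V\ge K$. Then the solution $P(V,t)$ of the problem \[ \frac{\partial P}{\partial t}+\frac12\sigma^2V^2\frac{\partial^2P}{\partial V^2}+(r-q)V\frac{\partial P}{\partial V}-rP=0,\quad V>V_b(t),\ 0\le t<T_1, \] \[ P(V_b(t),t)=0,\ 0\le t<T_1,\qquad P(V,T_1)=(E-B(V,T_1))^+,\ V>V_b(T_1)=be^{-a(T-T_1)}, \] is given by \[ \begin{aligned} P(V,t)={}&\big[Ee^{-r(T_1-t)}-Re^{-r(T-t)}\big]\Big\{N(b_1)-N(b_2)-\Big(\tfrac{V}{be^{-a(T-t)}}\Big)^{\gamma}\big[N(\tilde b_1)-N(\tilde b_2)\big]\Big\}\\ &-(1-R)e^{-r(T-t)}\Big\{N_2(d,b_1;\rho)-N_2(d,b_2;\rho)-\Big(\tfrac{V}{be^{-a(T-t)}}\Big)^{\gamma}\big[N_2(\tilde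 d,\tilde b_1;\rho)-N_2(\tilde d,\tilde b_2;\rho)\big]\\ &\qquad+\big[N_2(d,-b_1;-\rho)-N_2(d,-b_5;-\rho)\big]-\Big(\tfrac{V}{be^{-a(T-t)}}\Big)^{\gamma}\big[N_2(\tilde d,-\tilde b_1;-\rho)-N_2(\tilde d,-\tilde b_5;-\rho)\big]\Big\}, \end{aligned} \] where $\gamma=1-2(r-q-a)/\sigma^2$, $\rho=\sqrt{(T_1-t)/(T-t)}$, and \[ b_1=\frac{\ln\frac{V}{be^{-a(T-t)}}+(r-q-a-\frac{\sigma^2}{2})(T_1-t)}{\sigma\sqrt{T_1-t}},\qquad b_2=\frac{\ln\frac{V}{K}+(r-q-\frac{\sigma^2}{2})(T_1-t)}{\sigma\sqrt{T_1-t}}, \] \[ \tilde b_1=\frac{\ln\frac{be^{-a(T-t)}}{V}+(r-q-a-\frac{\sigma^2}{2})(T_1-t)}{\sigma\sqrt{T_1-t}},\qquad \tilde b_2=\frac{\ln\Big(\frac{be^{-a(T-T_1)}}{K}\cdot\frac{be^{-a(T-t)}}{V}\Big)+(r-q-a-\frac{\sigma^2}{2})(T_1-t)}{\sigma\sqrt{T_1-t}}, \] \[ b_5=\frac{-\ln\Big(\frac{be^{-a(T-T_1)}}{K}\cdot\frac{be^{-a(T-t)}}{V}\Big)+(r-q-a-\frac{\sigma^2}{2})(T_1-t)}{\sigma\sqrt{T_1-t}},\qquad \tilde b_5=\frac{\ln\frac{K}{V}+(r-q-2a-\frac{\sigma^2}{2})(T_1-t)}{\sigma\sqrt{T_1-t}},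 \] \[ d=\frac{\ln\frac{V}{be^{-a(T-t)}}+(r-q-a-\frac{\sigma^2}{2})(T-t)}{\sigma\sqrt{T-t}},\qquad \tilde d=\frac{\ln\frac{be^{-a(T-t)}}{V}+(r-q-a-\frac{\sigma^2}{2})(T-t)}{\sigma\sqrt{T-t}}. \]
   Context: $N(x)=\frac{1}{\sqrt{2\pi}}\int_{-\infty}^{x}e^{-s^2/2}\,ds$ is the standard normal distribution function and $N_2(a_1,a_2;\rho)=\frac{1}{2\pi\sqrt{1-\rho^2}}\int_{-\infty}^{a_1}\int_{-\infty}^{a_2}\exp\!\big(-\frac{y_1^2-2\rho y_1y_2+y_2^2}{2(1-\rho^2)}\big)dy_2\,dy_1$ is the bivariate standard normal distribution function with correlation $\rho$. $x^+=\max(x,0)$. (Interpretation: $P$ is the price of a put option with maturity $T_1$ and strike $E$ on a zero-coupon credit bond with price $B$, knocked out at default $V\le V_b(t)$.) *)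

theory Defs
  imports "HOL-Analysis.Analysis"
begin

definition Nd :: "real \<Rightarrow> real" where
  "Nd x = (LBINT s:{..x}. exp (- s\<^sup>2 / 2)) / sqrt (2 * pi)"

definition N2 :: "real \<Rightarrow> real \<Rightarrow> real \<Rightarrow> real" where
  "N2 a1 a2 \<rho> = (LBINT y1:{..a1}. LBINT y2:{..a2}.
      exp (- (y1\<^sup>2 - 2 * \<rho> * y1 * y2 + y2\<^sup>2) / (2 * (1 - \<rho>\<^sup>2))))
     / (2 * pi * sqrt (1 - \<rho>\<^sup>2))"

definition pos_part :: "real \<Rightarrow> real" where
  "pos_part x = max x 0"

definition Vb :: "real \<Rightarrow> real \<Rightarrow> real \<Rightarrow> real \<Rightarrow> real" where
  "Vb a b T t = b * exp (- a * (T - t))"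

definition Bbond :: "real \<Rightarrow> real \<Rightarrow> real \<Rightarrow> real \<Rightarrow> real \<Rightarrow> real \<Rightarrow> real \<Rightarrow> real \<Rightarrow> real \<Rightarrow> real" where
  "Bbond r q a \<sigma> b R T V t =
    (let d1 = (ln (V / b) + (r - q - \<sigma>\<^sup>2 / 2) * (T - t)) / (\<sigma> * sqrt (T - t));
         d2 = (ln (b / V) + (r - q - 2 * a - \<sigma>\<^sup>2 / 2) * (T - t)) / (\<sigma> * sqrt (T - t))
     in R * exp (- r * (T - t)) + (1 - R) * exp (- r * (T - t)) *
        (Nd d1 - (V / (b * exp (- a * (T - t)))) powr (1 - 2 * (r - q - a) / \<sigma>\<^sup>2) * Nd d2))"

definition Pput :: "real \<Rightarrow> real \<Rightarrow> real \<Rightarrow> real \<Rightarrow> real \<Rightarrow> real \<Rightarrow> real \<Rightarrow> real \<Rightarrow> real \<Rightarrow> real \<Rightarrow> real \<Rightarrow> real \<Rightarrow> real" where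
  "Pput r q a \<sigma> b R T T1 E K V t =
    (let \<gamma> = 1 - 2 * (r - q - a) / \<sigma>\<^sup>2;
         \<rho> = sqrt ((T1 - t) / (T - t));
         vb = b * exp (- a * (T - t));
         vb1 = b * exp (- a * (T - T1));
         s1 = \<sigma> * sqrt (T1 - t);
         s = \<sigma> * sqrt (T - t);
         b1 = (ln (V / vb) + (r - q - a - \<sigma>\<^sup>2 / 2) * (T1 - t)) / s1;
         b2 = (ln (V / K) + (r - q - \<sigma>\<^sup>2 / 2) * (T1 - t)) / s1;
         tb1 = (ln (vb / V) + (r - q - a - \<sigma>\<^sup>2 / 2) * (T1 - t)) / s1;
         tb2 = (ln ((vb1 / K) * (vb / V)) + (r - q - a - \<sigma>\<^sup>2 / 2) * (T1 - t)) / s1;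
         b5 = (- ln ((vb1 / K) * (vb / V)) + (r - q - a - \<sigma>\<^sup>2 / 2) * (T1 - t)) / s1;
         tb5 = (ln (K / V) + (r - q - 2 * a - \<sigma>\<^sup>2 / 2) * (T1 - t)) / s1;
         d = (ln (V / vb) + (r - q - a - \<sigma>\<^sup>2 / 2) * (T - t)) / s;
         td = (ln (vb / V) + (r - q - a - \<sigma>\<^sup>2 / 2) * (T - t)) / s;
         w = (V / vb) powr \<gamma>
     in (E * exp (- r * (T1 - t)) - R * exp (- r * (T - t))) *
          (Nd b1 - Nd b2 - w * (Nd tb1 - Nd tb2))
        - (1 - R) * exp (- r * (T - t)) *
          (N2 d b1 \<rho> - N2 d b2 \<rho> - w * (N2 td tb1 \<rho> - N2 td tb2 \<rho>)
           + (N2 d (- b1) (- \<rho>) - N2 d (- b5) (- \<rho>))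
           - w * (N2 td (- tb1) (- \<rho>) - N2 td (- tb5) (- \<rho>))))"

end

theory Submission
  imports Defs "HOL-Probability.Characteristic_Functions"
begin

text \<open>
  In the coordinate \<open>x = ln (V / V\<^sub>b(t))\<close> the barrier sits at \<open>x = 0\<close> and the Black--Scholes operator
  becomes that of a Brownian motion with drift \<open>\<mu> = r - q - a - \<sigma>\<^sup>2/2\<close> and volatility \<open>\<sigma>\<close>. Its
  transition density satisfies \<open>exp (\<gamma> x) p(-x, -y) = exp (\<gamma> y) p(x, y)\<close>, so by the method of images
  \<open>p(x, y) - exp (\<gamma> x) p(-x, y)\<close> is the density of the motion killed at the barrier.
  Conditioning the bivariate normal distribution on its second variable and folding \<open>(-k, k)\<close> onto
  \<open>(0, k)\<close>, where \<open>k = ln (K / V\<^sub>b(T\<^sub>1))\<close>, turns the closed formula into the discounted integral of the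
  payoff \<open>E - B\<close> over \<open>(0, k)\<close> against the killed density. The boundary value is then immediate,
  differentiation under the integral sign gives the equation, and concentration of the Gaussian
  kernel gives the terminal value. At \<open>V = K\<close>, where the truncated payoff could jump, \<open>E - B\<close>
  vanishes by continuity.
\<close>

section \<open>The univariate and bivariate normal distribution functions\<close>

lemma Nd_eq_lebesgue_integral:
  "Nd x = (LINT z|lborel. std_normal_density z * indicator {..x} z)"
  by (simp add: Nd_def set_lebesgue_integral_def std_normal_density_def mult.commute
      flip: integral_divide_zero)

lemma Nd_eq_cdf: "Nd = cdf std_normal_distribution"
proof
  fix x
  have "cdf std_normal_distribution x = (LINT z|std_normal_distribution. indicator {..x} z)"
    by (simp add: cdf_def)
  also have "\<dots> = Nd x"
    by (subst integral_density) (simp_all add: Nd_eq_lebesgue_integral)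
  finally show "Nd x = cdf std_normal_distribution x" ..
qed

lemma abs_Nd_le_1: "\<bar>Nd x\<bar> \<le> 1"
  by (simp add: Nd_eq_cdf cdf_def real_distribution.axioms(1)[OF real_dist_normal_dist]
      prob_space.prob_le_1)

lemma isCont_Nd: "isCont Nd x"
proof -
  interpret real_distribution std_normal_distribution
    by (rule real_dist_normal_dist)
  have "measure std_normal_distribution {x} = 0"
    by (simp add: measure_def emeasure_density)
  then show ?thesis
    by (simp add: Nd_eq_cdf isCont_cdf)
qed

lemma continuous_on_Nd [continuous_intros]:
  "continuous_on A f \<Longrightarrow> continuous_on A (\<lambda>x. Nd (f x))"
  by (rule continuous_on_compose2[of UNIV Nd])
    (auto intro!: continuous_at_imp_continuous_on isCont_Nd)

lemma borel_measurable_Nd [measurable]: "Nd \<in> borel_measurable borel"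
  by (intro borel_measurable_continuous_onI continuous_intros)

lemma integrable_normal_density_mult_bounded:
  fixes f :: "real \<Rightarrow> real"
  assumes "s > 0" and [measurable]: "f \<in> borel_measurable borel" and bound: "\<And>y. \<bar>f y\<bar> \<le> C"
  shows "integrable lborel (\<lambda>y. normal_density m s y * f y)"
proof (rule Bochner_Integration.integrable_bound)
  show "integrable lborel (\<lambda>y. C * normal_density m s y)"
    using assms(1) by simp
  have "\<bar>normal_density m s y * f y\<bar> \<le> normal_density m s y * C" for y
    by (simp add: abs_mult bound mult_left_mono)
  then show "AE y in lborel. norm (normal_density m s y * f y) \<le> norm (C * normal_density m s y)"
    by (intro AE_I2) (metis abs_ge_self mult.commute order_trans real_norm_def)
qed simp

lemma integral_normal_density_standardize:
  fixes f :: "real \<Rightarrow> real"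
  assumes "s \<noteq> 0"
  shows "(LINT y|lborel. normal_density m s y * f y)
    = (LINT z|lborel. std_normal_density z * f (m + s * z))"
proof -
  have standardize: "\<bar>s\<bar> * normal_density m s (m + s * z) = std_normal_density z" for z
    using assms by (simp add: normal_density_def power_mult_distrib real_sqrt_mult)
  have "(LINT y|lborel. normal_density m s y * f y)
      = \<bar>s\<bar> *\<^sub>R (LINT z|lborel. normal_density m s (m + s * z) * f (m + s * z))"
    using assms by (rule lborel_integral_real_affine)
  also have "\<dots> = (LINT z|lborel. \<bar>s\<bar> * normal_density m s (m + s * z) * f (m + s * z))"
    by (simp add: mult.assoc)
  finally show ?thesis
    by (simp only: standardize)
qed

lemma integral_normal_density_atMost:
  assumes "s > 0"
  shows "(LINT y|lborel. normal_density m s y * indicator {..a} y) = Nd ((a - m) / s)"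
proof -
  have "indicator {..a} (m + s * z) = (indicator {..(a - m) / s} z :: real)" for z
    using assms by (simp add: indicator_def field_simps)
  then show ?thesis
    using assms
    by (subst integral_normal_density_standardize) (simp_all add: Nd_eq_lebesgue_integral)
qed

lemma bivariate_normal_density_factor:
  fixes \<rho> :: real
  assumes "\<bar>\<rho>\<bar> < 1"
  shows "exp (- (y1\<^sup>2 - 2 * \<rho> * y1 * y2 + y2\<^sup>2) / (2 * (1 - \<rho>\<^sup>2))) / (2 * pi * sqrt (1 - \<rho>\<^sup>2))
    = std_normal_density y2 * normal_density (\<rho> * y2) (sqrt (1 - \<rho>\<^sup>2)) y1"
proof -
  have pos: "1 - \<rho>\<^sup>2 > 0" using assms by (simp add: abs_square_less_1)
  have exponent: "- (y1\<^sup>2 - 2 * \<rho> * y1 * y2 + y2\<^sup>2) / (2 * (1 - \<rho>\<^sup>2))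
      = - y2\<^sup>2 / 2 + - (y1 - \<rho> * y2)\<^sup>2 / (2 * (1 - \<rho>\<^sup>2))"
    using pos by (simp add: divide_simps) (simp add: power2_eq_square algebra_simps)
  have "sqrt (2 * pi) * sqrt (2 * pi * (1 - \<rho>\<^sup>2)) = 2 * pi * sqrt (1 - \<rho>\<^sup>2)"
    by (simp only: real_sqrt_mult[of "2 * pi"] mult.assoc[symmetric] real_sqrt_mult_self) simp
  then show ?thesis
    unfolding exponent exp_add using pos by (simp add: normal_density_def)
qed

text \<open>Conditioning on the second variable.\<close>
lemma N2_eq_lebesgue_integral:
  fixes \<rho> :: real
  assumes "\<bar>\<rho>\<bar> < 1"
  shows "N2 a1 a2 \<rho> = (LINT y|lborel. std_normal_density y *
      (indicator {..a2} y * Nd ((a1 - \<rho> * y) / sqrt (1 - \<rho>\<^sup>2))))"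
proof -
  define s where "s = sqrt (1 - \<rho>\<^sup>2)"
  have s: "s > 0" using assms by (simp add: s_def abs_square_less_1)
  define g where "g y2 y1 = std_normal_density y2 * indicator {..a2} y2 *
      (normal_density (\<rho> * y2) s y1 * indicator {..a1} y1)" for y1 y2
  have [measurable]: "(\<lambda>x. g (fst x) (snd x)) \<in> borel_measurable (borel \<Otimes>\<^sub>M borel)"
    unfolding g_def normal_density_def by measurable
  have g_nonneg: "g y2 y1 \<ge> 0" for y1 y2
    by (simp add: g_def)
  have inner: "(LINT y1|lborel. g y2 y1)
      = std_normal_density y2 * (indicator {..a2} y2 * Nd ((a1 - \<rho> * y2) / s))" for y2
    unfolding g_def by (simp add: integral_normal_density_atMost[OF s])
  have integrable_inner: "integrable lborel (g y2)" for y2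
    unfolding g_def using s
    by (intro integrable_mult_right integrable_normal_density_mult_bounded[where C = 1])
      (auto simp: indicator_def)
  have integrable_outer: "integrable lborel (\<lambda>y2. LINT y1|lborel. g y2 y1)"
    unfolding inner
    by (intro integrable_normal_density_mult_bounded[where C = 1])
      (auto simp: indicator_def abs_Nd_le_1)
  have "integrable (lborel \<Otimes>\<^sub>M lborel) (\<lambda>(y2, y1). g y2 y1)"
    using integrable_inner integrable_outer
    by (intro lborel_pair.Fubini_integrable) (simp_all add: case_prod_beta g_nonneg)
  note Fubini = lborel_pair.Fubini_integral[OF this]
  have "N2 a1 a2 \<rho> = (LINT y1|lborel. LINT y2|lborel. indicator {..a1} y1 * (indicator {..a2} y2 *
      (exp (- (y1\<^sup>2 - 2 * \<rho> * y1 * y2 + y2\<^sup>2) / (2 * (1 - \<rho>\<^sup>2))) / (2 * pi * sqrt (1 - \<rho>\<^sup>2)))))"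
    unfolding N2_def set_lebesgue_integral_def by simp
  also have "\<dots> = (LINT y1|lborel. LINT y2|lborel. g y2 y1)"
    unfolding bivariate_normal_density_factor[OF assms] g_def s_def by (simp add: mult_ac)
  also have "\<dots> = (LINT y2|lborel. LINT y1|lborel. g y2 y1)"
    by (rule Fubini)
  finally show ?thesis by (simp add: inner s_def)
qed

section \<open>Concentration of the normal density\<close>

lemma normal_density_integral_tendsto:
  fixes f :: "real \<Rightarrow> real" and m s :: "'a \<Rightarrow> real"
  assumes [measurable]: "f \<in> borel_measurable borel" and bound: "\<And>y. \<bar>f y\<bar> \<le> C"
    and cont: "isCont f x" and m: "(m \<longlongrightarrow> x) F" and s: "(s \<longlongrightarrow> 0) F" "\<forall>\<^sub>F i in F. s i \<noteq> 0"
  shows "((\<lambda>i. LINT y|lborel. normal_density (m i) (s i) y * f y) \<longlongrightarrow> f x) F"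
proof -
  define I where "I p = (LINT z|lborel. std_normal_density z * f (fst p + snd p * z))" for p
  have "isCont I (x, 0)"
    unfolding continuous_at_sequentially
  proof (intro allI impI)
    fix p :: "nat \<Rightarrow> real \<times> real" assume p: "p \<longlonglongrightarrow> (x, 0)"
    have arg: "(\<lambda>i. fst (p i) + snd (p i) * z) \<longlonglongrightarrow> x + 0 * z" for z
      using tendsto_fst[OF p] tendsto_snd[OF p] by (intro tendsto_intros) auto
    show "(I \<circ> p) \<longlonglongrightarrow> I (x, 0)"
      unfolding I_def o_def fst_conv snd_conv
    proof (rule integral_dominated_convergence[where w = "\<lambda>z. std_normal_density z * C"])
      show "AE z in lborel. (\<lambda>i. std_normal_density z * f (fst (p i) + snd (p i) * z))
          \<longlonglongrightarrow> std_normal_density z * f (x + 0 * z)"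
        using cont by (intro AE_I2 tendsto_mult_left isCont_tendsto_compose[OF _ arg]) simp
    qed (auto simp: abs_mult bound intro!: mult_left_mono)
  qed
  then have "((\<lambda>i. I (m i, s i)) \<longlongrightarrow> I (x, 0)) F"
    by (rule isCont_tendsto_compose) (intro tendsto_Pair m s(1))
  moreover have "\<forall>\<^sub>F i in F. I (m i, s i) = (LINT y|lborel. normal_density (m i) (s i) y * f y)"
    unfolding I_def fst_conv snd_conv
    using s(2) by eventually_elim (rule integral_normal_density_standardize[symmetric])
  ultimately show ?thesis
    by (simp add: I_def tendsto_cong)
qed

lemma isCont_indicator_mult:
  fixes f :: "'a::t2_space \<Rightarrow> real"
  assumes cont: "isCont f x" and frontier: "x \<in> frontier A \<Longrightarrow> f x = 0"
  shows "isCont (\<lambda>y. indicator A y * f y) x"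
proof (cases "x \<in> frontier A")
  case True
  then have "((\<lambda>y. \<bar>f y\<bar>) \<longlongrightarrow> 0) (at x)"
    using cont frontier by (simp add: isCont_def tendsto_rabs_zero_iff)
  then have "((\<lambda>y. indicator A y * f y) \<longlongrightarrow> 0) (at x)"
    by (rule Lim_null_comparison[rotated]) (simp add: indicator_def)
  then show ?thesis
    using True frontier by (simp add: isCont_def)
next
  case False
  then show ?thesis
    using cont by (intro continuous_intros) (simp add: isCont_indicator)
qed

lemma normal_density_Icc_integral_tendsto:
  fixes f :: "real \<Rightarrow> real" and m s :: "'a \<Rightarrow> real"
  assumes cont: "continuous_on UNIV f" and endpoint: "x \<in> {\<alpha>, \<beta>} \<Longrightarrow> f x = 0"
    and m: "(m \<longlongrightarrow> x) F" and s: "(s \<longlongrightarrow> 0) F" "\<forall>\<^sub>F i in F. s i \<noteq> 0"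
  shows "((\<lambda>i. integral {\<alpha>..\<beta>} (\<lambda>y. normal_density (m i) (s i) y * f y))
    \<longlongrightarrow> indicator {\<alpha>..\<beta>} x * f x) F"
proof -
  have [measurable]: "f \<in> borel_measurable borel"
    using cont by (rule borel_measurable_continuous_onI)
  have "bounded (f ` {\<alpha>..\<beta>})"
    using cont by (intro compact_imp_bounded compact_continuous_image)
      (auto intro: continuous_on_subset)
  then obtain C where C: "\<forall>y\<in>{\<alpha>..\<beta>}. \<bar>f y\<bar> \<le> C" "C > 0"
    by (auto simp: bounded_pos)
  have "((\<lambda>i. LINT y|lborel. normal_density (m i) (s i) y * (indicator {\<alpha>..\<beta>} y * f y))
      \<longlongrightarrow> indicator {\<alpha>..\<beta>} x * f x) F"
  proof (rule normal_density_integral_tendsto[OF _ _ isCont_indicator_mult m s])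
    show "\<bar>indicator {\<alpha>..\<beta>} y * f y\<bar> \<le> C" for y
      using C by (auto simp: indicator_def)
    show "isCont f x"
      using cont by (simp add: continuous_on_eq_continuous_at)
    show "f x = 0" if "x \<in> frontier {\<alpha>..\<beta>}"
      using that endpoint by (auto simp: frontier_def)
  qed auto
  moreover have "\<forall>\<^sub>F i in F.
      (LINT y|lborel. normal_density (m i) (s i) y * (indicator {\<alpha>..\<beta>} y * f y))
      = integral {\<alpha>..\<beta>} (\<lambda>y. normal_density (m i) (s i) y * f y)"
    using s(2)
  proof eventually_elim
    case (elim i)
    have "set_integrable lborel {\<alpha>..\<beta>} (\<lambda>y. normal_density (m i) (s i) y * f y)"
      unfolding normal_density_def using elim cont
      by (intro borel_integrable_atLeastAtMost' continuous_intros) (auto intro: continuous_on_subset)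
    from set_borel_integral_eq_integral(2)[OF this] show ?case
      by (simp add: set_lebesgue_integral_def mult.left_commute)
  qed
  ultimately show ?thesis
    by (simp add: tendsto_cong)
qed

section \<open>Brownian motion with drift\<close>

definition bm_density :: "real \<Rightarrow> real \<Rightarrow> real \<Rightarrow> real \<Rightarrow> real \<Rightarrow> real" where
  "bm_density \<mu> \<sigma> \<tau> x y = normal_density (x + \<mu> * \<tau>) (\<sigma> * sqrt \<tau>) y"

definition bm_zscore :: "real \<Rightarrow> real \<Rightarrow> real \<Rightarrow> real \<Rightarrow> real \<Rightarrow> real" where
  "bm_zscore \<mu> \<sigma> \<tau> x c = (x - c + \<mu> * \<tau>) / (\<sigma> * sqrt \<tau>)"

lemma integrable_bm_density_mult_bounded:
  fixes f :: "real \<Rightarrow> real"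
  assumes "\<sigma> > 0" "\<tau> > 0" "f \<in> borel_measurable borel" "\<And>y. \<bar>f y\<bar> \<le> C"
  shows "integrable lborel (\<lambda>y. bm_density \<mu> \<sigma> \<tau> x y * f y)"
  unfolding bm_density_def using assms by (intro integrable_normal_density_mult_bounded) auto

lemma continuous_on_bm_density [continuous_intros]:
  assumes "\<sigma> > 0" "continuous_on A \<tau>" "continuous_on A x" "continuous_on A y" "\<And>a. a \<in> A \<Longrightarrow> \<tau> a > 0"
  shows "continuous_on A (\<lambda>a. bm_density \<mu> \<sigma> (\<tau> a) (x a) (y a))"
  unfolding bm_density_def normal_density_def using assms
  by (intro continuous_intros) (auto dest: order_less_imp_not_eq2)

lemma continuous_on_bm_zscore [continuous_intros]:
  assumes "\<sigma> > 0" "\<tau> > 0" "continuous_on A x"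
  shows "continuous_on A (\<lambda>a. bm_zscore \<mu> \<sigma> \<tau> (x a) c)"
  unfolding bm_zscore_def using assms by (intro continuous_intros) auto

lemma bm_density_Icc_integral_tendsto:
  fixes f :: "real \<Rightarrow> real" and \<tau> x :: "'a \<Rightarrow> real"
  assumes "\<sigma> > 0" and f: "continuous_on UNIV f" "z \<in> {\<alpha>, \<beta>} \<Longrightarrow> f z = 0"
    and x: "(x \<longlongrightarrow> z) F" and \<tau>: "(\<tau> \<longlongrightarrow> 0) F" "\<forall>\<^sub>F i in F. \<tau> i > 0"
  shows "((\<lambda>i. integral {\<alpha>..\<beta>} (\<lambda>y. bm_density \<mu> \<sigma> (\<tau> i) (x i) y * f y))
    \<longlongrightarrow> indicator {\<alpha>..\<beta>} z * f z) F"
  unfolding bm_density_def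
proof (rule normal_density_Icc_integral_tendsto[OF f])
  show "((\<lambda>i. x i + \<mu> * \<tau> i) \<longlongrightarrow> z) F"
    using tendsto_add[OF x tendsto_mult_right_zero[OF \<tau>(1)]] by simp
  show "((\<lambda>i. \<sigma> * sqrt (\<tau> i)) \<longlongrightarrow> 0) F"
    using tendsto_mult_right_zero[OF tendsto_real_sqrt[OF \<tau>(1), unfolded real_sqrt_zero]] .
  show "\<forall>\<^sub>F i in F. \<sigma> * sqrt (\<tau> i) \<noteq> 0"
    using \<tau>(2) by eventually_elim (use assms(1) in auto)
qed

lemma set_integral_bm_density_atLeast:
  assumes "\<sigma> > 0" "\<tau> > 0"
  shows "(LBINT y:{c..}. bm_density \<mu> \<sigma> \<tau> x y * f y) = (LINT z|lborel. std_normal_density z *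
    (indicator {..bm_zscore \<mu> \<sigma> \<tau> x c} z * f (x + \<mu> * \<tau> - \<sigma> * sqrt \<tau> * z)))"
proof -
  have "(LBINT y:{c..}. bm_density \<mu> \<sigma> \<tau> x y * f y)
      = (LINT y|lborel. normal_density (x + \<mu> * \<tau>) (- (\<sigma> * sqrt \<tau>)) y * (indicator {c..} y * f y))"
    by (simp add: set_lebesgue_integral_def bm_density_def normal_density_def mult.left_commute)
  also have "\<dots> = (LINT z|lborel. std_normal_density z *
      (indicator {c..} (x + \<mu> * \<tau> + - (\<sigma> * sqrt \<tau>) * z) * f (x + \<mu> * \<tau> + - (\<sigma> * sqrt \<tau>) * z)))"
    using assms by (intro integral_normal_density_standardize) simp
  also have "(\<lambda>z. indicator {c..} (x + \<mu> * \<tau> + - (\<sigma> * sqrt \<tau>) * z) :: real)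
      = indicator {..bm_zscore \<mu> \<sigma> \<tau> x c}"
    using assms by (auto simp: fun_eq_iff indicator_def bm_zscore_def field_simps)
  finally show ?thesis by simp
qed

lemma set_integral_bm_density_atMost:
  assumes "\<sigma> > 0" "\<tau> > 0"
  shows "(LBINT y:{..c}. bm_density \<mu> \<sigma> \<tau> x y * f y) = (LINT z|lborel. std_normal_density z *
    (indicator {..- bm_zscore \<mu> \<sigma> \<tau> x c} z * f (x + \<mu> * \<tau> + \<sigma> * sqrt \<tau> * z)))"
proof -
  have "(LBINT y:{..c}. bm_density \<mu> \<sigma> \<tau> x y * f y)
      = (LINT y|lborel. normal_density (x + \<mu> * \<tau>) (\<sigma> * sqrt \<tau>) y * (indicator {..c} y * f y))"
    by (simp add: set_lebesgue_integral_def bm_density_def mult.left_commute)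
  also have "\<dots> = (LINT z|lborel. std_normal_density z *
      (indicator {..c} (x + \<mu> * \<tau> + \<sigma> * sqrt \<tau> * z) * f (x + \<mu> * \<tau> + \<sigma> * sqrt \<tau> * z)))"
    using assms by (intro integral_normal_density_standardize) simp
  also have "(\<lambda>z. indicator {..c} (x + \<mu> * \<tau> + \<sigma> * sqrt \<tau> * z) :: real)
      = indicator {..- bm_zscore \<mu> \<sigma> \<tau> x c}"
    using assms by (auto simp: fun_eq_iff indicator_def bm_zscore_def field_simps)
  finally show ?thesis .
qed

lemma bm_zscore_conditional:
  assumes "\<sigma> > 0" "0 < \<tau>" "\<tau> < \<tau>'"
  shows "(bm_zscore \<mu> \<sigma> \<tau>' x c - sqrt (\<tau> / \<tau>') * z) / sqrt (1 - (sqrt (\<tau> / \<tau>'))\<^sup>2)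
    = bm_zscore \<mu> \<sigma> (\<tau>' - \<tau>) (x + \<mu> * \<tau> - \<sigma> * sqrt \<tau> * z) c"
proof -
  have "1 - (sqrt (\<tau> / \<tau>'))\<^sup>2 = (\<tau>' - \<tau>) / \<tau>'"
    using assms by (simp add: diff_divide_distrib)
  then have "sqrt (1 - (sqrt (\<tau> / \<tau>'))\<^sup>2) = sqrt (\<tau>' - \<tau>) / sqrt \<tau>'"
    by (simp only: real_sqrt_divide)
  moreover have "bm_zscore \<mu> \<sigma> \<tau>' x c - sqrt (\<tau> / \<tau>') * z
      = (x + \<mu> * \<tau> - \<sigma> * sqrt \<tau> * z - c + \<mu> * (\<tau>' - \<tau>)) / (\<sigma> * sqrt \<tau>')"
    using assms by (simp add: bm_zscore_def real_sqrt_divide field_simps)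
  ultimately show ?thesis
    using assms by (simp add: bm_zscore_def)
qed

text \<open>For the Brownian motion \<open>X\<close> started at \<open>x\<close>, \<open>Nd (bm_zscore \<mu> \<sigma> \<tau> x c)\<close> is the probability of
  \<open>X\<^sub>\<tau> \<ge> c\<close>. The bivariate distribution function gives the joint probabilities of \<open>X\<^bsub>\<tau>'\<^esub> \<ge> c'\<close> with
  \<open>X\<^sub>\<tau> \<ge> c\<close> (correlation \<open>sqrt (\<tau> / \<tau>')\<close>) and with \<open>X\<^sub>\<tau> \<le> c\<close> (the opposite correlation).\<close>
lemma Nd_bm_zscore:
  assumes "\<sigma> > 0" "\<tau> > 0"
  shows "Nd (bm_zscore \<mu> \<sigma> \<tau> x c) = (LBINT y:{c..}. bm_density \<mu> \<sigma> \<tau> x y)"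
  using set_integral_bm_density_atLeast[OF assms, of c \<mu> x "\<lambda>_. 1"]
  by (simp add: Nd_eq_lebesgue_integral)

lemma N2_bm_zscore_upper:
  assumes "\<sigma> > 0" "0 < \<tau>" "\<tau> < \<tau>'"
  shows "N2 (bm_zscore \<mu> \<sigma> \<tau>' x c') (bm_zscore \<mu> \<sigma> \<tau> x c) (sqrt (\<tau> / \<tau>'))
    = (LBINT y:{c..}. bm_density \<mu> \<sigma> \<tau> x y * Nd (bm_zscore \<mu> \<sigma> (\<tau>' - \<tau>) y c'))"
  unfolding set_integral_bm_density_atLeast[OF assms(1,2)] bm_zscore_conditional[OF assms, symmetric]
  using assms by (intro N2_eq_lebesgue_integral) simp

lemma N2_bm_zscore_lower:
  assumes "\<sigma> > 0" "0 < \<tau>" "\<tau> < \<tau>'"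
  shows "N2 (bm_zscore \<mu> \<sigma> \<tau>' x c') (- bm_zscore \<mu> \<sigma> \<tau> x c) (- sqrt (\<tau> / \<tau>'))
    = (LBINT y:{..c}. bm_density \<mu> \<sigma> \<tau> x y * Nd (bm_zscore \<mu> \<sigma> (\<tau>' - \<tau>) y c'))"
proof -
  have "bm_zscore \<mu> \<sigma> (\<tau>' - \<tau>) (x + \<mu> * \<tau> + \<sigma> * sqrt \<tau> * z) c'
      = (bm_zscore \<mu> \<sigma> \<tau>' x c' - - sqrt (\<tau> / \<tau>') * z) / sqrt (1 - (- sqrt (\<tau> / \<tau>'))\<^sup>2)" for z
    using bm_zscore_conditional[OF assms, of \<mu> x c' "- z"] by simp
  then show ?thesis
    unfolding set_integral_bm_density_atMost[OF assms(1,2)]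
    using assms by (subst N2_eq_lebesgue_integral) simp_all
qed

lemma integrable_bm_density_mult_Nd:
  assumes "\<sigma> > 0" "\<tau> > 0"
  shows "integrable lborel (\<lambda>y. bm_density \<mu> \<sigma> \<tau> x y * Nd (bm_zscore \<mu> \<sigma> \<tau>' y c))"
  using assms by (intro integrable_bm_density_mult_bounded[where C = 1])
    (simp_all add: abs_Nd_le_1 bm_zscore_def)

lemma set_integral_diff_eq_integral_Icc:
  fixes f :: "real \<Rightarrow> real"
  assumes f: "integrable lborel f" and [measurable]: "A \<in> sets borel" "B \<in> sets borel"
    and diff: "B \<subseteq> A" "A - B \<subseteq> {\<alpha>..\<beta>}" "{\<alpha><..<\<beta>} \<subseteq> A - B"
  shows "(LBINT y:A. f y) - (LBINT y:B. f y) = integral {\<alpha>..\<beta>} f"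
proof -
  have integrable: "set_integrable lborel S f" if "S \<in> sets borel" for S
    unfolding set_integrable_def using that f by (intro integrable_mult_indicator) auto
  have "(LBINT y:A. f y) = (LBINT y:(A - B) \<union> B. f y)"
    using diff by (simp add: Un_absorb2)
  also have "\<dots> = (LBINT y:A - B. f y) + (LBINT y:B. f y)"
    by (intro set_integral_Un integrable) auto
  also have "(LBINT y:A - B. f y) = (LBINT y:{\<alpha>..\<beta>}. f y)"
  proof (rule set_integral_discrete_difference[where X = "{\<alpha>, \<beta>}"])
    have "{\<alpha>..\<beta>} - {\<alpha>, \<beta>} \<subseteq> {\<alpha><..<\<beta>}"
      by auto
    then show "(A - B - {\<alpha>..\<beta>}) \<union> ({\<alpha>..\<beta>} - (A - B)) \<subseteq> {\<alpha>, \<beta>}"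
      using diff by blast
  qed auto
  also have "\<dots> = integral {\<alpha>..\<beta>} f"
    by (intro set_borel_integral_eq_integral integrable) simp
  finally show ?thesis by simp
qed

lemma Nd_bm_zscore_diff:
  assumes "\<sigma> > 0" "\<tau> > 0" "c \<le> c'"
  shows "Nd (bm_zscore \<mu> \<sigma> \<tau> x c) - Nd (bm_zscore \<mu> \<sigma> \<tau> x c')
    = integral {c..c'} (bm_density \<mu> \<sigma> \<tau> x)"
  unfolding Nd_bm_zscore[OF assms(1,2)] using assms
  by (intro set_integral_diff_eq_integral_Icc) (auto simp: bm_density_def[abs_def])

lemma N2_bm_zscore_upper_diff:
  assumes "\<sigma> > 0" "0 < \<tau>" "\<tau> < \<tau>'" "\<alpha> \<le> \<beta>"
  defines "\<rho> \<equiv> sqrt (\<tau> / \<tau>')"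
  shows "N2 (bm_zscore \<mu> \<sigma> \<tau>' x c) (bm_zscore \<mu> \<sigma> \<tau> x \<alpha>) \<rho>
      - N2 (bm_zscore \<mu> \<sigma> \<tau>' x c) (bm_zscore \<mu> \<sigma> \<tau> x \<beta>) \<rho>
    = integral {\<alpha>..\<beta>} (\<lambda>y. bm_density \<mu> \<sigma> \<tau> x y * Nd (bm_zscore \<mu> \<sigma> (\<tau>' - \<tau>) y c))"
  unfolding \<rho>_def N2_bm_zscore_upper[OF assms(1-3)] using assms
  by (intro set_integral_diff_eq_integral_Icc integrable_bm_density_mult_Nd) auto

lemma N2_bm_zscore_lower_diff:
  assumes "\<sigma> > 0" "0 < \<tau>" "\<tau> < \<tau>'" "\<alpha> \<le> \<beta>"
  defines "\<rho> \<equiv> sqrt (\<tau> / \<tau>')"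
  shows "N2 (bm_zscore \<mu> \<sigma> \<tau>' x c) (- bm_zscore \<mu> \<sigma> \<tau> x \<beta>) (- \<rho>)
      - N2 (bm_zscore \<mu> \<sigma> \<tau>' x c) (- bm_zscore \<mu> \<sigma> \<tau> x \<alpha>) (- \<rho>)
    = integral {\<alpha>..\<beta>} (\<lambda>y. bm_density \<mu> \<sigma> \<tau> x y * Nd (bm_zscore \<mu> \<sigma> (\<tau>' - \<tau>) y c))"
  unfolding \<rho>_def N2_bm_zscore_lower[OF assms(1-3)] using assms
  by (intro set_integral_diff_eq_integral_Icc integrable_bm_density_mult_Nd) auto

section \<open>The method of images\<close>

definition subtract_image :: "real \<Rightarrow> (real \<Rightarrow> real) \<Rightarrow> real \<Rightarrow> real" where
  "subtract_image \<gamma> f x = f x - exp (\<gamma> * x) * f (- x)"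

lemma continuous_on_subtract_image:
  assumes "continuous_on UNIV f"
  shows "continuous_on A (subtract_image \<gamma> f)"
  unfolding subtract_image_def
  by (intro continuous_intros continuous_on_compose2[OF assms]) auto

text \<open>The exponent \<open>-2\<mu>/\<sigma>\<^sup>2\<close> is exactly the one for which reflecting both the starting point and
  the end point multiplies the transition density by a ratio of exponentials.\<close>
lemma bm_density_reflect:
  assumes "\<sigma> > 0" "\<tau> > 0" "\<gamma> = - 2 * \<mu> / \<sigma>\<^sup>2"
  shows "exp (\<gamma> * x) * bm_density \<mu> \<sigma> \<tau> (- x) (- y) = exp (\<gamma> * y) * bm_density \<mu> \<sigma> \<tau> x y"
proof -
  have "(\<sigma> * sqrt \<tau>)\<^sup>2 = \<sigma>\<^sup>2 * \<tau>"
    using assms by (simp add: power_mult_distrib)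
  moreover have "- 2 * \<mu> / \<sigma>\<^sup>2 * x + - (- y - (- x + \<mu> * \<tau>))\<^sup>2 / (2 * (\<sigma>\<^sup>2 * \<tau>))
      = - 2 * \<mu> / \<sigma>\<^sup>2 * y + - (y - (x + \<mu> * \<tau>))\<^sup>2 / (2 * (\<sigma>\<^sup>2 * \<tau>))"
    using assms(1,2) by (simp add: divide_simps) (simp add: power2_eq_square algebra_simps)
  then have "exp (\<gamma> * x) * exp (- (- y - (- x + \<mu> * \<tau>))\<^sup>2 / (2 * (\<sigma>\<^sup>2 * \<tau>)))
      = exp (\<gamma> * y) * exp (- (y - (x + \<mu> * \<tau>))\<^sup>2 / (2 * (\<sigma>\<^sup>2 * \<tau>)))"
    by (simp only: assms(3) exp_add[symmetric])
  ultimately show ?thesis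
    by (simp add: bm_density_def normal_density_def)
qed

lemma integral_bm_density_reflect:
  assumes "\<sigma> > 0" "\<tau> > 0" "\<gamma> = - 2 * \<mu> / \<sigma>\<^sup>2"
  shows "integral {- \<beta>..- \<alpha>} (\<lambda>y. bm_density \<mu> \<sigma> \<tau> x y * f y)
    = exp (\<gamma> * x) * integral {\<alpha>..\<beta>} (\<lambda>y. bm_density \<mu> \<sigma> \<tau> (- x) y * (exp (\<gamma> * y) * f (- y)))"
proof -
  have reflect: "bm_density \<mu> \<sigma> \<tau> x (- y) * f (- y)
      = exp (\<gamma> * x) * (bm_density \<mu> \<sigma> \<tau> (- x) y * (exp (\<gamma> * y) * f (- y)))" for y
    using bm_density_reflect[OF assms, of x "- y"] by (simp add: exp_minus field_simps)
  have "integral {- \<beta>..- \<alpha>} (\<lambda>y. bm_density \<mu> \<sigma> \<tau> x y * f y)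
      = integral {\<alpha>..\<beta>} (\<lambda>y. bm_density \<mu> \<sigma> \<tau> x (- y) * f (- y))"
    using Henstock_Kurzweil_Integration.integral_reflect_real
      [of "- \<alpha>" "- \<beta>" "\<lambda>y. bm_density \<mu> \<sigma> \<tau> x y * f y"] by simp
  then show ?thesis
    by (simp add: reflect)
qed

lemma subtract_image_integral_symmetric:
  assumes "\<sigma> > 0" "\<tau> > 0" "\<gamma> = - 2 * \<mu> / \<sigma>\<^sup>2" "k \<ge> 0" and f: "continuous_on UNIV f"
  shows "subtract_image \<gamma> (\<lambda>x. integral {- k..k} (\<lambda>y. bm_density \<mu> \<sigma> \<tau> x y * f y)) x
    = subtract_image \<gamma> (\<lambda>x. integral {0..k} (\<lambda>y. bm_density \<mu> \<sigma> \<tau> x y * subtract_image \<gamma> f y)) x"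
proof -
  define image where "image y = exp (\<gamma> * y) * f (- y)" for y
  define J where "J g x = integral {0..k} (\<lambda>y. bm_density \<mu> \<sigma> \<tau> x y * g y)" for g x
  have image: "continuous_on UNIV image"
    unfolding image_def by (intro continuous_intros continuous_on_compose2[OF f]) auto
  have integrable: "(\<lambda>y. bm_density \<mu> \<sigma> \<tau> x y * g y) integrable_on {\<alpha>..\<beta>}"
    if "continuous_on UNIV g" for g x \<alpha> \<beta>
    using assms that
    by (intro integrable_continuous_real continuous_intros) (auto intro: continuous_on_subset)
  have folded: "integral {- k..k} (\<lambda>y. bm_density \<mu> \<sigma> \<tau> x y * f y)
      = J f x + exp (\<gamma> * x) * J image (- x)" for x
  proof -
    have "integral {- k..k} (\<lambda>y. bm_density \<mu> \<sigma> \<tau> x y * f y)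
        = integral {- k..0} (\<lambda>y. bm_density \<mu> \<sigma> \<tau> x y * f y) + J f x"
      unfolding J_def using assms(4)
      by (intro Henstock_Kurzweil_Integration.integral_combine[symmetric] integrable f) auto
    then show ?thesis
      using integral_bm_density_reflect[OF assms(1-3), of k 0 x f] by (simp add: J_def image_def)
  qed
  have "J (subtract_image \<gamma> f) x = J f x - J image x" for x
    unfolding J_def subtract_image_def image_def[symmetric] right_diff_distrib
    by (intro Henstock_Kurzweil_Integration.integral_diff integrable f image)
  then have "subtract_image \<gamma> (J (subtract_image \<gamma> f)) x
      = J f x - J image x - exp (\<gamma> * x) * (J f (- x) - J image (- x))"
    by (simp only: subtract_image_def[of \<gamma> "J _"])
  also have "\<dots> = subtract_image \<gamma> (\<lambda>x. J f x + exp (\<gamma> * x) * J image (- x)) x"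
    by (simp add: subtract_image_def exp_minus algebra_simps)
  finally show ?thesis
    by (simp only: folded J_def[symmetric])
qed

section \<open>The Black--Scholes equation\<close>

definition black_scholes_at ::
    "real \<Rightarrow> real \<Rightarrow> real \<Rightarrow> (real \<Rightarrow> real \<Rightarrow> real) \<Rightarrow> real \<Rightarrow> real \<Rightarrow> bool" where
  "black_scholes_at r q \<sigma> P V t \<longleftrightarrow> (\<exists>Pt PV PVV.
    (P V has_real_derivative Pt) (at t) \<and>
    (\<forall>\<^sub>F v in nhds V. ((\<lambda>w. P w t) has_real_derivative PV v) (at v)) \<and>
    (PV has_real_derivative PVV) (at V) \<and>
    Pt + 1/2 * \<sigma>\<^sup>2 * V\<^sup>2 * PVV + (r - q) * V * PV V - r * P V t = 0)"

lemma black_scholes_atI: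
  assumes "(P V has_real_derivative Pt) (at t)"
    and "\<forall>\<^sub>F v in nhds V. ((\<lambda>w. P w t) has_real_derivative PV v) (at v)"
    and "(PV has_real_derivative PVV) (at V)"
    and "Pt + 1/2 * \<sigma>\<^sup>2 * V\<^sup>2 * PVV + (r - q) * V * PV V - r * P V t = 0"
  shows "black_scholes_at r q \<sigma> P V t"
  unfolding black_scholes_at_def using assms by blast

lemma black_scholes_atE:
  assumes "black_scholes_at r q \<sigma> P V t"
  obtains Pt PV PVV where "(P V has_real_derivative Pt) (at t)"
    and "\<forall>\<^sub>F v in nhds V. ((\<lambda>w. P w t) has_real_derivative PV v) (at v)"
    and "(PV has_real_derivative PVV) (at V)"
    and "Pt + 1/2 * \<sigma>\<^sup>2 * V\<^sup>2 * PVV + (r - q) * V * PV V - r * P V t = 0"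
  using assms unfolding black_scholes_at_def by blast

lemma black_scholes_at_imp_deriv:
  assumes "black_scholes_at r q \<sigma> P V t"
  shows "\<exists>Pt PV PVV. (P V has_real_derivative Pt) (at t) \<and>
    ((\<lambda>v. P v t) has_real_derivative PV) (at V) \<and>
    (\<forall>\<^sub>F v in nhds V. (\<lambda>w. P w t) differentiable (at v)) \<and>
    (deriv (\<lambda>w. P w t) has_real_derivative PVV) (at V) \<and>
    Pt + 1/2 * \<sigma>\<^sup>2 * V\<^sup>2 * PVV + (r - q) * V * PV - r * P V t = 0"
proof -
  obtain Pt PV PVV where time: "(P V has_real_derivative Pt) (at t)"
    and space: "\<forall>\<^sub>F v in nhds V. ((\<lambda>w. P w t) has_real_derivative PV v) (at v)"
    and second: "(PV has_real_derivative PVV) (at V)"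
    and pde: "Pt + 1/2 * \<sigma>\<^sup>2 * V\<^sup>2 * PVV + (r - q) * V * PV V - r * P V t = 0"
    using assms by (rule black_scholes_atE)
  have "\<forall>\<^sub>F v in nhds V. (\<lambda>w. P w t) differentiable (at v)"
    using space by eventually_elim (auto simp: real_differentiable_def)
  moreover have "\<forall>\<^sub>F v in nhds V. PV v = deriv (\<lambda>w. P w t) v"
    using space by eventually_elim (rule DERIV_imp_deriv[symmetric])
  then have "(deriv (\<lambda>w. P w t) has_real_derivative PVV) (at V)"
    using second DERIV_cong_ev by blast
  ultimately show ?thesis
    using time eventually_nhds_x_imp_x[OF space] pde by blast
qed

lemma black_scholes_at_diff:
  assumes "black_scholes_at r q \<sigma> P V t" "black_scholes_at r q \<sigma> Q V t"
  shows "black_scholes_at r q \<sigma> (\<lambda>V t. P V t - Q V t) V t"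
proof -
  obtain Pt PV PVV where P: "(P V has_real_derivative Pt) (at t)"
    "\<forall>\<^sub>F v in nhds V. ((\<lambda>w. P w t) has_real_derivative PV v) (at v)"
    "(PV has_real_derivative PVV) (at V)"
    "Pt + 1/2 * \<sigma>\<^sup>2 * V\<^sup>2 * PVV + (r - q) * V * PV V - r * P V t = 0"
    using assms(1) by (rule black_scholes_atE)
  obtain Qt QV QVV where Q: "(Q V has_real_derivative Qt) (at t)"
    "\<forall>\<^sub>F v in nhds V. ((\<lambda>w. Q w t) has_real_derivative QV v) (at v)"
    "(QV has_real_derivative QVV) (at V)"
    "Qt + 1/2 * \<sigma>\<^sup>2 * V\<^sup>2 * QVV + (r - q) * V * QV V - r * Q V t = 0"
    using assms(2) by (rule black_scholes_atE)
  have "\<forall>\<^sub>F v in nhds V. ((\<lambda>w. P w t - Q w t) has_real_derivative PV v - QV v) (at v)"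
    using P(2) Q(2) by eventually_elim (rule DERIV_diff)
  moreover have "(Pt - Qt) + 1/2 * \<sigma>\<^sup>2 * V\<^sup>2 * (PVV - QVV) + (r - q) * V * (PV V - QV V)
      - r * (P V t - Q V t) = 0"
    using P(4) Q(4) by (simp add: algebra_simps diff_divide_distrib)
  ultimately show ?thesis
    using DERIV_diff[OF P(1) Q(1)] DERIV_diff[OF P(3) Q(3)] by (intro black_scholes_atI)
qed

lemma black_scholes_at_cong:
  assumes "black_scholes_at r q \<sigma> P V t"
    and time: "\<forall>\<^sub>F s in nhds t. P V s = Q V s" and space: "\<forall>\<^sub>F v in nhds V. P v t = Q v t"
  shows "black_scholes_at r q \<sigma> Q V t"
proof -
  obtain Pt PV PVV where P: "(P V has_real_derivative Pt) (at t)"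
    "\<forall>\<^sub>F v in nhds V. ((\<lambda>w. P w t) has_real_derivative PV v) (at v)"
    "(PV has_real_derivative PVV) (at V)"
    "Pt + 1/2 * \<sigma>\<^sup>2 * V\<^sup>2 * PVV + (r - q) * V * PV V - r * P V t = 0"
    using assms(1) by (rule black_scholes_atE)
  have "(Q V has_real_derivative Pt) (at t)"
    using P(1) DERIV_cong_ev[OF refl time refl] by simp
  moreover have "\<forall>\<^sub>F v in nhds V. \<forall>\<^sub>F w in nhds v. P w t = Q w t"
    using space by (simp add: eventually_eventually)
  with P(2) have "\<forall>\<^sub>F v in nhds V. ((\<lambda>w. Q w t) has_real_derivative PV v) (at v)"
    by eventually_elim (simp add: DERIV_cong_ev[OF refl _ refl])
  moreover have "P V t = Q V t"
    using space by (rule eventually_nhds_x_imp_x)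
  ultimately show ?thesis
    using P(3,4) by (intro black_scholes_atI) simp_all
qed

text \<open>The substitution \<open>x = ln V\<close>, \<open>\<tau> = T - t\<close> turns the Black--Scholes equation into the backward
  equation of the Brownian motion with drift \<open>r - q - \<sigma>\<^sup>2 / 2\<close> and volatility \<open>\<sigma>\<close>.\<close>
lemma black_scholes_at_discounted_log:
  assumes V: "V > 0"
    and u\<tau>: "((\<lambda>\<tau>. u \<tau> (ln V)) has_real_derivative u\<tau>) (at (T - t))"
    and ux: "\<And>x. (u (T - t) has_real_derivative ux x) (at x)"
    and uxx: "(ux has_real_derivative uxx) (at (ln V))"
    and backward: "u\<tau> = (r - q - \<sigma>\<^sup>2 / 2) * ux (ln V) + \<sigma>\<^sup>2 / 2 * uxx"
  shows "black_scholes_at r q \<sigma> (\<lambda>V t. exp (- r * (T - t)) * u (T - t) (ln V)) V t"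
proof -
  define D where "D = exp (- r * (T - t))"
  have "((\<lambda>t. exp (- r * (T - t))) has_real_derivative r * D) (at t)"
    by (auto simp: D_def intro!: derivative_eq_intros)
  moreover have "((\<lambda>t. T - t) has_real_derivative - 1) (at t)"
    by (auto intro!: derivative_eq_intros)
  with u\<tau> have "((\<lambda>t. u (T - t) (ln V)) has_real_derivative u\<tau> * - 1) (at t)"
    by (rule DERIV_chain2)
  ultimately have time: "((\<lambda>t. exp (- r * (T - t)) * u (T - t) (ln V)) has_real_derivative
      r * D * u (T - t) (ln V) + u\<tau> * - 1 * D) (at t)"
    unfolding D_def by (rule DERIV_mult)
  have log: "((\<lambda>v. g (ln v)) has_real_derivative g' / v) (at v)"
    if "v > 0" "(g has_real_derivative g') (at (ln v))" for g g' v
    using DERIV_chain2[OF that(2) DERIV_ln_divide[OF that(1)]] by simp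
  have "\<forall>\<^sub>F v in nhds V. v \<in> {0<..}"
    using V by (intro eventually_nhds_in_open) auto
  then have space: "\<forall>\<^sub>F v in nhds V.
      ((\<lambda>w. D * u (T - t) (ln w)) has_real_derivative D * (ux (ln v) / v)) (at v)"
    by eventually_elim (intro DERIV_cmult log ux; simp)
  have "((\<lambda>v. ux (ln v) / v) has_real_derivative (uxx / V * V - ux (ln V) * 1) / (V * V)) (at V)"
    using V by (intro DERIV_divide log uxx DERIV_ident) auto
  then have second: "((\<lambda>v. D * (ux (ln v) / v)) has_real_derivative
      D * ((uxx - ux (ln V)) / V\<^sup>2)) (at V)"
    using V by (intro DERIV_cmult) (simp add: power2_eq_square)
  have "r * D * u (T - t) (ln V) + u\<tau> * - 1 * D + 1/2 * \<sigma>\<^sup>2 * V\<^sup>2 * (D * ((uxx - ux (ln V)) / V\<^sup>2))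
      + (r - q) * V * (D * (ux (ln V) / V)) - r * (D * u (T - t) (ln V)) = 0"
    using V by (simp add: backward field_simps)
  with time space second show ?thesis
    unfolding D_def by (rule black_scholes_atI)
qed

lemma has_real_derivative_integral_Icc:
  fixes f :: "real \<Rightarrow> real \<Rightarrow> real"
  assumes S: "open S" "convex S" "x \<in> S"
    and deriv: "\<And>x y. x \<in> S \<Longrightarrow> y \<in> {\<alpha>..\<beta>} \<Longrightarrow> ((\<lambda>x. f x y) has_real_derivative f' x y) (at x)"
    and cont: "\<And>x. x \<in> S \<Longrightarrow> continuous_on {\<alpha>..\<beta>} (f x)"
    and cont': "continuous_on (S \<times> {\<alpha>..\<beta>}) (\<lambda>p. f' (fst p) (snd p))"
  shows "((\<lambda>x. integral {\<alpha>..\<beta>} (f x)) has_real_derivative integral {\<alpha>..\<beta>} (f' x)) (at x)"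
proof -
  have "((\<lambda>x. integral (cbox \<alpha> \<beta>) (f x)) has_real_derivative integral (cbox \<alpha> \<beta>) (f' x))
      (at x within S)"
  proof (rule leibniz_rule_field_derivative)
    show "((\<lambda>x. f x y) has_real_derivative f' x y) (at x within S)" if "x \<in> S" "y \<in> cbox \<alpha> \<beta>" for x y
      using deriv that by (simp add: has_field_derivative_at_within)
    show "f x integrable_on cbox \<alpha> \<beta>" if "x \<in> S" for x
      using cont that by (simp add: integrable_continuous_real)
  qed (use S cont' in \<open>simp_all add: case_prod_beta\<close>)
  then show ?thesis
    using S by (simp add: at_within_open_NO_MATCH)
qed

definition bm_score :: "real \<Rightarrow> real \<Rightarrow> real \<Rightarrow> real \<Rightarrow> real \<Rightarrow> real" where
  "bm_score \<mu> \<sigma> \<tau> x y = (y - x - \<mu> * \<tau>) / (\<sigma>\<^sup>2 * \<tau>)"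

lemma continuous_on_bm_score [continuous_intros]:
  assumes "\<sigma> > 0" "continuous_on A \<tau>" "continuous_on A x" "continuous_on A y" "\<And>a. a \<in> A \<Longrightarrow> \<tau> a > 0"
  shows "continuous_on A (\<lambda>a. bm_score \<mu> \<sigma> (\<tau> a) (x a) (y a))"
  unfolding bm_score_def using assms by (intro continuous_intros) (auto dest: order_less_imp_not_eq2)

lemma bm_score_has_derivative_start:
  "((\<lambda>x. bm_score \<mu> \<sigma> \<tau> x y) has_real_derivative - 1 / (\<sigma>\<^sup>2 * \<tau>)) (at x)"
  unfolding bm_score_def by (rule DERIV_cdivide) (auto intro!: derivative_eq_intros)

lemma bm_density_eq_exp:
  assumes "\<sigma> > 0" "\<tau> > 0"
  shows "bm_density \<mu> \<sigma> \<tau> x y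
    = exp (- (y - x - \<mu> * \<tau>)\<^sup>2 / (2 * \<sigma>\<^sup>2 * \<tau>)) / (sqrt (2 * pi) * \<sigma> * sqrt \<tau>)"
  using assms
  by (simp add: bm_density_def normal_density_def power_mult_distrib real_sqrt_mult diff_diff_eq
      mult_ac)

lemma bm_density_has_derivative_start:
  assumes "\<sigma> > 0" "\<tau> > 0"
  shows "((\<lambda>x. bm_density \<mu> \<sigma> \<tau> x y) has_real_derivative
    bm_density \<mu> \<sigma> \<tau> x y * bm_score \<mu> \<sigma> \<tau> x y) (at x)"
proof -
  have "((\<lambda>x. - (y - x - \<mu> * \<tau>)\<^sup>2 / (2 * \<sigma>\<^sup>2 * \<tau>)) has_real_derivative bm_score \<mu> \<sigma> \<tau> x y) (at x)"
    using assms by (auto simp: bm_score_def field_simps intro!: derivative_eq_intros)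
  from DERIV_cdivide[OF DERIV_fun_exp[OF this]] show ?thesis
    using assms by (simp add: bm_density_eq_exp)
qed

lemma bm_density_mult_score_has_derivative_start:
  assumes "\<sigma> > 0" "\<tau> > 0"
  shows "((\<lambda>x. bm_density \<mu> \<sigma> \<tau> x y * bm_score \<mu> \<sigma> \<tau> x y) has_real_derivative
    bm_density \<mu> \<sigma> \<tau> x y * ((bm_score \<mu> \<sigma> \<tau> x y)\<^sup>2 - 1 / (\<sigma>\<^sup>2 * \<tau>))) (at x)"
  using DERIV_mult[OF bm_density_has_derivative_start[OF assms, of \<mu> y x]
      bm_score_has_derivative_start[of \<mu> \<sigma> \<tau> y x]]
  by (simp add: power2_eq_square algebra_simps)

lemma bm_exponent_has_derivative_time:
  assumes "\<sigma> > 0" "\<tau> > 0"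
  shows "((\<lambda>\<tau>. - (y - x - \<mu> * \<tau>)\<^sup>2 / (2 * \<sigma>\<^sup>2 * \<tau>)) has_real_derivative
    \<mu> * bm_score \<mu> \<sigma> \<tau> x y + \<sigma>\<^sup>2 / 2 * (bm_score \<mu> \<sigma> \<tau> x y)\<^sup>2) (at \<tau>)"
proof -
  define w where "w = y - x - \<mu> * \<tau>"
  have "((\<lambda>\<tau>. - (y - x - \<mu> * \<tau>)\<^sup>2) has_real_derivative 2 * \<mu> * w) (at \<tau>)"
    "((\<lambda>\<tau>. 2 * \<sigma>\<^sup>2 * \<tau>) has_real_derivative 2 * \<sigma>\<^sup>2) (at \<tau>)"
    by (auto simp: w_def intro!: derivative_eq_intros)
  then have "((\<lambda>\<tau>. - (y - x - \<mu> * \<tau>)\<^sup>2 / (2 * \<sigma>\<^sup>2 * \<tau>)) has_real_derivative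
      (2 * \<mu> * w * (2 * \<sigma>\<^sup>2 * \<tau>) - - w\<^sup>2 * (2 * \<sigma>\<^sup>2)) / (2 * \<sigma>\<^sup>2 * \<tau> * (2 * \<sigma>\<^sup>2 * \<tau>))) (at \<tau>)"
    unfolding w_def using assms by (intro DERIV_divide) auto
  also have "(2 * \<mu> * w * (2 * \<sigma>\<^sup>2 * \<tau>) - - w\<^sup>2 * (2 * \<sigma>\<^sup>2)) / (2 * \<sigma>\<^sup>2 * \<tau> * (2 * \<sigma>\<^sup>2 * \<tau>))
      = \<mu> * (w / (\<sigma>\<^sup>2 * \<tau>)) + \<sigma>\<^sup>2 / 2 * (w / (\<sigma>\<^sup>2 * \<tau>))\<^sup>2"
    using assms by (simp add: field_simps power2_eq_square)
  finally show ?thesis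
    by (simp only: bm_score_def w_def)
qed

lemma bm_density_has_derivative_time:
  assumes "\<sigma> > 0" "\<tau> > 0"
  shows "((\<lambda>\<tau>. bm_density \<mu> \<sigma> \<tau> x y) has_real_derivative bm_density \<mu> \<sigma> \<tau> x y *
    (\<mu> * bm_score \<mu> \<sigma> \<tau> x y + \<sigma>\<^sup>2 / 2 * ((bm_score \<mu> \<sigma> \<tau> x y)\<^sup>2 - 1 / (\<sigma>\<^sup>2 * \<tau>)))) (at \<tau>)"
proof -
  define n where "n \<tau> = sqrt (2 * pi) * \<sigma> * sqrt \<tau>" for \<tau>
  define e where "e \<tau> = exp (- (y - x - \<mu> * \<tau>)\<^sup>2 / (2 * \<sigma>\<^sup>2 * \<tau>))" for \<tau>
  define e' where "e' = \<mu> * bm_score \<mu> \<sigma> \<tau> x y + \<sigma>\<^sup>2 / 2 * (bm_score \<mu> \<sigma> \<tau> x y)\<^sup>2"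
  have density: "e s / n s = bm_density \<mu> \<sigma> s x y" if "s > 0" for s
    using assms that by (simp add: bm_density_eq_exp e_def n_def)
  have normalizer: "n \<tau> \<noteq> 0" "(n has_real_derivative n \<tau> / (2 * \<tau>)) (at \<tau>)"
    using assms by (auto simp: n_def[abs_def] field_simps intro!: derivative_eq_intros)
  have exponential: "(e has_real_derivative e \<tau> * e') (at \<tau>)"
    unfolding e_def[abs_def] e'_def by (intro DERIV_fun_exp bm_exponent_has_derivative_time assms)
  have "((\<lambda>\<tau>. e \<tau> / n \<tau>) has_real_derivative
      (e \<tau> * e' * n \<tau> - e \<tau> * (n \<tau> / (2 * \<tau>))) / (n \<tau> * n \<tau>)) (at \<tau>)"
    by (rule DERIV_divide[OF exponential normalizer(2,1)])
  also have "(e \<tau> * e' * n \<tau> - e \<tau> * (n \<tau> / (2 * \<tau>))) / (n \<tau> * n \<tau>) = e \<tau> / n \<tau> * (e' - 1 / (2 * \<tau>))"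
    using normalizer(1) assms by (simp add: field_simps)
  finally have "((\<lambda>\<tau>. bm_density \<mu> \<sigma> \<tau> x y) has_real_derivative
      e \<tau> / n \<tau> * (e' - 1 / (2 * \<tau>))) (at \<tau>)"
    by (rule has_field_derivative_transform_within_open[where S = "{0<..}"])
      (use assms density in auto)
  moreover have "e' - 1 / (2 * \<tau>)
      = \<mu> * bm_score \<mu> \<sigma> \<tau> x y + \<sigma>\<^sup>2 / 2 * ((bm_score \<mu> \<sigma> \<tau> x y)\<^sup>2 - 1 / (\<sigma>\<^sup>2 * \<tau>))"
    using assms by (simp add: e'_def field_simps)
  ultimately show ?thesis
    by (simp only: density[OF assms(2)])
qed

lemma integral_bm_density_has_derivative_start:
  fixes f h :: "real \<Rightarrow> real"
  assumes "\<sigma> > 0" "\<tau> > 0" and f: "continuous_on {\<alpha>..\<beta>} f" and h: "continuous_on {\<alpha>..\<beta>} h"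
  shows "((\<lambda>x. integral {\<alpha>..\<beta>} (\<lambda>y. bm_density \<mu> \<sigma> \<tau> x (h y) * f y)) has_real_derivative
    integral {\<alpha>..\<beta>} (\<lambda>y. bm_density \<mu> \<sigma> \<tau> x (h y) * bm_score \<mu> \<sigma> \<tau> x (h y) * f y)) (at x)"
proof (rule has_real_derivative_integral_Icc[of UNIV])
  show "((\<lambda>x. bm_density \<mu> \<sigma> \<tau> x (h y) * f y) has_real_derivative
      bm_density \<mu> \<sigma> \<tau> x (h y) * bm_score \<mu> \<sigma> \<tau> x (h y) * f y) (at x)" for x y
    using assms by (intro DERIV_cmult_right bm_density_has_derivative_start)
  show "continuous_on (UNIV \<times> {\<alpha>..\<beta>}) (\<lambda>p. bm_density \<mu> \<sigma> \<tau> (fst p) (h (snd p)) *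
      bm_score \<mu> \<sigma> \<tau> (fst p) (h (snd p)) * f (snd p))"
    using assms
    by (intro continuous_intros continuous_on_compose2[OF f] continuous_on_compose2[OF h]) auto
  show "continuous_on {\<alpha>..\<beta>} (\<lambda>y. bm_density \<mu> \<sigma> \<tau> x (h y) * f y)" for x
    using assms by (intro continuous_intros) auto
qed auto

lemma integral_bm_density_mult_score_has_derivative_start:
  fixes f h :: "real \<Rightarrow> real"
  assumes "\<sigma> > 0" "\<tau> > 0" and f: "continuous_on {\<alpha>..\<beta>} f" and h: "continuous_on {\<alpha>..\<beta>} h"
  shows "((\<lambda>x. integral {\<alpha>..\<beta>} (\<lambda>y. bm_density \<mu> \<sigma> \<tau> x (h y) * bm_score \<mu> \<sigma> \<tau> x (h y) * f y))
    has_real_derivative integral {\<alpha>..\<beta>} (\<lambda>y. bm_density \<mu> \<sigma> \<tau> x (h y) *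
      ((bm_score \<mu> \<sigma> \<tau> x (h y))\<^sup>2 - 1 / (\<sigma>\<^sup>2 * \<tau>)) * f y)) (at x)"
proof (rule has_real_derivative_integral_Icc[of UNIV])
  show "((\<lambda>x. bm_density \<mu> \<sigma> \<tau> x (h y) * bm_score \<mu> \<sigma> \<tau> x (h y) * f y) has_real_derivative
      bm_density \<mu> \<sigma> \<tau> x (h y) * ((bm_score \<mu> \<sigma> \<tau> x (h y))\<^sup>2 - 1 / (\<sigma>\<^sup>2 * \<tau>)) * f y) (at x)" for x y
    using assms by (intro DERIV_cmult_right bm_density_mult_score_has_derivative_start)
  show "continuous_on (UNIV \<times> {\<alpha>..\<beta>}) (\<lambda>p. bm_density \<mu> \<sigma> \<tau> (fst p) (h (snd p)) *
      ((bm_score \<mu> \<sigma> \<tau> (fst p) (h (snd p)))\<^sup>2 - 1 / (\<sigma>\<^sup>2 * \<tau>)) * f (snd p))"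
    using assms
    by (intro continuous_intros continuous_on_compose2[OF f] continuous_on_compose2[OF h]) auto
  show "continuous_on {\<alpha>..\<beta>} (\<lambda>y. bm_density \<mu> \<sigma> \<tau> x (h y) * bm_score \<mu> \<sigma> \<tau> x (h y) * f y)" for x
    using assms by (intro continuous_intros) auto
qed auto

lemma integral_bm_density_has_derivative_time:
  fixes f h :: "real \<Rightarrow> real"
  assumes "\<sigma> > 0" "\<tau> > 0" and f: "continuous_on {\<alpha>..\<beta>} f" and h: "continuous_on {\<alpha>..\<beta>} h"
  shows "((\<lambda>\<tau>. integral {\<alpha>..\<beta>} (\<lambda>y. bm_density \<mu> \<sigma> \<tau> x (h y) * f y)) has_real_derivative
    integral {\<alpha>..\<beta>} (\<lambda>y. bm_density \<mu> \<sigma> \<tau> x (h y) * (\<mu> * bm_score \<mu> \<sigma> \<tau> x (h y) +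
      \<sigma>\<^sup>2 / 2 * ((bm_score \<mu> \<sigma> \<tau> x (h y))\<^sup>2 - 1 / (\<sigma>\<^sup>2 * \<tau>))) * f y)) (at \<tau>)"
proof (rule has_real_derivative_integral_Icc[of "{0<..}"])
  show "((\<lambda>\<tau>. bm_density \<mu> \<sigma> \<tau> x (h y) * f y) has_real_derivative
      bm_density \<mu> \<sigma> \<tau> x (h y) * (\<mu> * bm_score \<mu> \<sigma> \<tau> x (h y) +
        \<sigma>\<^sup>2 / 2 * ((bm_score \<mu> \<sigma> \<tau> x (h y))\<^sup>2 - 1 / (\<sigma>\<^sup>2 * \<tau>))) * f y) (at \<tau>)"
    if "\<tau> \<in> {0<..}" for \<tau> y
    using assms that by (intro DERIV_cmult_right bm_density_has_derivative_time) auto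
  show "continuous_on ({0<..} \<times> {\<alpha>..\<beta>}) (\<lambda>p. bm_density \<mu> \<sigma> (fst p) x (h (snd p)) *
      (\<mu> * bm_score \<mu> \<sigma> (fst p) x (h (snd p)) +
        \<sigma>\<^sup>2 / 2 * ((bm_score \<mu> \<sigma> (fst p) x (h (snd p)))\<^sup>2 - 1 / (\<sigma>\<^sup>2 * fst p))) * f (snd p))"
    using assms
    by (intro continuous_intros continuous_on_compose2[OF f] continuous_on_compose2[OF h]) auto
  show "continuous_on {\<alpha>..\<beta>} (\<lambda>y. bm_density \<mu> \<sigma> \<tau> x (h y) * f y)" if "\<tau> \<in> {0<..}" for \<tau>
    using assms that by (intro continuous_intros) auto
qed (use assms in auto)

text \<open>The end point \<open>y\<close> is reparametrized by \<open>h\<close> so that both the direct term and the image term of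
  the method of images are instances.\<close>
lemma black_scholes_at_bm_density_integral:
  fixes f h :: "real \<Rightarrow> real"
  assumes \<sigma>: "\<sigma> > 0" and t: "t < T" and V: "V > 0"
    and f: "continuous_on {\<alpha>..\<beta>} f" and h: "continuous_on {\<alpha>..\<beta>} h"
  shows "black_scholes_at r q \<sigma> (\<lambda>V t. exp (- r * (T - t)) *
    integral {\<alpha>..\<beta>} (\<lambda>y. bm_density (r - q - \<sigma>\<^sup>2 / 2) \<sigma> (T - t) (ln V) (h y) * f y)) V t"
proof -
  define \<mu> \<tau> x where "\<mu> = r - q - \<sigma>\<^sup>2 / 2" and "\<tau> = T - t" and "x = ln V"
  define p where "p y = bm_density \<mu> \<sigma> \<tau> x (h y)" for y
  define z where "z y = bm_score \<mu> \<sigma> \<tau> x (h y)" for y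
  have \<tau>: "\<tau> > 0" using t by (simp add: \<tau>_def)
  have "(\<lambda>y. p y * z y * f y) integrable_on {\<alpha>..\<beta>}"
    "(\<lambda>y. p y * ((z y)\<^sup>2 - 1 / (\<sigma>\<^sup>2 * \<tau>)) * f y) integrable_on {\<alpha>..\<beta>}"
    unfolding p_def z_def using \<sigma> \<tau>
    by (intro integrable_continuous_real continuous_intros f h; simp)+
  then have "((\<lambda>y. \<mu> * (p y * z y * f y) + \<sigma>\<^sup>2 / 2 * (p y * ((z y)\<^sup>2 - 1 / (\<sigma>\<^sup>2 * \<tau>)) * f y))
      has_integral \<mu> * integral {\<alpha>..\<beta>} (\<lambda>y. p y * z y * f y)
        + \<sigma>\<^sup>2 / 2 * integral {\<alpha>..\<beta>} (\<lambda>y. p y * ((z y)\<^sup>2 - 1 / (\<sigma>\<^sup>2 * \<tau>)) * f y)) {\<alpha>..\<beta>}"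
    by (intro has_integral_add has_integral_mult_right integrable_integral)
  moreover have "\<mu> * (p y * z y * f y) + \<sigma>\<^sup>2 / 2 * (p y * ((z y)\<^sup>2 - 1 / (\<sigma>\<^sup>2 * \<tau>)) * f y)
      = p y * (\<mu> * z y + \<sigma>\<^sup>2 / 2 * ((z y)\<^sup>2 - 1 / (\<sigma>\<^sup>2 * \<tau>))) * f y" for y
    by (simp only: distrib_left distrib_right mult_ac)
  ultimately have backward:
    "integral {\<alpha>..\<beta>} (\<lambda>y. p y * (\<mu> * z y + \<sigma>\<^sup>2 / 2 * ((z y)\<^sup>2 - 1 / (\<sigma>\<^sup>2 * \<tau>))) * f y)
      = \<mu> * integral {\<alpha>..\<beta>} (\<lambda>y. p y * z y * f y)
        + \<sigma>\<^sup>2 / 2 * integral {\<alpha>..\<beta>} (\<lambda>y. p y * ((z y)\<^sup>2 - 1 / (\<sigma>\<^sup>2 * \<tau>)) * f y)"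
    by (simp only: integral_unique)
  show ?thesis
    unfolding \<mu>_def[symmetric]
    using integral_bm_density_has_derivative_time[OF \<sigma> \<tau> f h]
      integral_bm_density_has_derivative_start[OF \<sigma> \<tau> f h]
      integral_bm_density_mult_score_has_derivative_start[OF \<sigma> \<tau> f h]
      backward
    unfolding p_def z_def \<mu>_def \<tau>_def x_def
    by (rule black_scholes_at_discounted_log[OF V])
qed

section \<open>The knock-out put\<close>

locale knockout_put =
  fixes r q a \<sigma> b R T T1 E K :: real
  assumes \<sigma>_pos: "\<sigma> > 0" and b_pos: "b > 0" and T1_less_T: "T1 < T"
    and K_ge: "K \<ge> Vb a b T T1"
begin

abbreviation barrier :: "real \<Rightarrow> real" where "barrier \<equiv> Vb a b T"

abbreviation bond :: "real \<Rightarrow> real" where "bond V \<equiv> Bbond r q a \<sigma> b R T V T1"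

abbreviation price :: "real \<Rightarrow> real \<Rightarrow> real" where "price \<equiv> Pput r q a \<sigma> b R T T1 E K"

definition \<mu> :: real where "\<mu> = r - q - a - \<sigma>\<^sup>2 / 2"

definition \<gamma> :: real where "\<gamma> = 1 - 2 * (r - q - a) / \<sigma>\<^sup>2"

definition log_dist :: "real \<Rightarrow> real \<Rightarrow> real" where "log_dist V t = ln (V / barrier t)"

definition log_strike :: real where "log_strike = log_dist K T1"

definition payoff :: "real \<Rightarrow> real" where "payoff y = E - bond (barrier T1 * exp y)"

definition survival :: "real \<Rightarrow> real" where
  "survival = subtract_image \<gamma> (\<lambda>y. Nd (bm_zscore \<mu> \<sigma> (T - T1) y 0))"

lemma \<gamma>_eq: "\<gamma> = - 2 * \<mu> / \<sigma>\<^sup>2"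
  using \<sigma>_pos by (simp add: \<gamma>_def \<mu>_def field_simps)

lemma barrier_pos: "barrier t > 0"
  using b_pos by (simp add: Vb_def)

lemma K_pos: "K > 0"
  using K_ge barrier_pos[of T1] by simp

lemma ln_barrier: "ln (barrier t) = ln b - a * (T - t)"
  using b_pos by (simp add: Vb_def ln_mult)

lemma log_dist_eq: "V > 0 \<Longrightarrow> log_dist V t = ln V - ln b + a * (T - t)"
  using barrier_pos[of t] by (simp add: log_dist_def ln_div ln_barrier)

lemma tendsto_log_dist:
  assumes "(v \<longlongrightarrow> V) F" "(s \<longlongrightarrow> t) F" "V > 0"
  shows "((\<lambda>i. log_dist (v i) (s i)) \<longlongrightarrow> log_dist V t) F"
  unfolding log_dist_def Vb_def using assms b_pos by (intro tendsto_intros) auto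

lemma powr_\<gamma>_eq: "V > 0 \<Longrightarrow> (V / barrier t) powr \<gamma> = exp (\<gamma> * log_dist V t)"
  using barrier_pos[of t] by (simp add: powr_def log_dist_def)

lemma log_strike_nonneg: "log_strike \<ge> 0"
  using K_ge barrier_pos[of T1] by (simp add: log_strike_def log_dist_def)

lemma payoff_log_dist: "V > 0 \<Longrightarrow> payoff (log_dist V T1) = E - bond V"
  using barrier_pos[of T1] by (simp add: payoff_def log_dist_def)

lemma bond_eq_survival:
  assumes "V > 0"
  shows "bond V = R * exp (- r * (T - T1))
    + (1 - R) * exp (- r * (T - T1)) * survival (log_dist V T1)"
proof -
  have d1: "ln (V / b) + (r - q - \<sigma>\<^sup>2 / 2) * (T - T1) = log_dist V T1 - 0 + \<mu> * (T - T1)"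
    using assms b_pos by (simp add: log_dist_eq \<mu>_def ln_div algebra_simps)
  have d2: "ln (b / V) + (r - q - 2 * a - \<sigma>\<^sup>2 / 2) * (T - T1) = - log_dist V T1 - 0 + \<mu> * (T - T1)"
    using assms b_pos by (simp add: log_dist_eq \<mu>_def ln_div algebra_simps)
  show ?thesis
    unfolding Bbond_def Let_def d1 d2 Vb_def[symmetric] \<gamma>_def[symmetric] powr_\<gamma>_eq[OF assms]
    by (simp add: survival_def subtract_image_def bm_zscore_def)
qed

lemma payoff_eq_survival:
  "payoff y = (E - R * exp (- r * (T - T1))) - (1 - R) * exp (- r * (T - T1)) * survival y"
  using bond_eq_survival[of "barrier T1 * exp y"] barrier_pos[of T1]
  by (simp add: payoff_def log_dist_def)

lemma continuous_on_Nd_bm_zscore: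
  "continuous_on A (\<lambda>y. Nd (bm_zscore \<mu> \<sigma> (T - T1) y c))"
  using \<sigma>_pos T1_less_T by (intro continuous_intros) auto

lemma continuous_on_survival: "continuous_on A survival"
  unfolding survival_def by (intro continuous_on_subtract_image continuous_on_Nd_bm_zscore)

lemma continuous_on_payoff: "continuous_on A payoff"
  unfolding payoff_eq_survival[abs_def] by (intro continuous_intros continuous_on_survival)

text \<open>For the logarithmic distance \<open>X\<close> from the barrier, started at \<open>x\<close> at time \<open>t\<close>: the probability
  of \<open>0 < X\<^bsub>T1\<^esub> < log_strike\<close>, and that of \<open>X\<^bsub>T\<^esub> > 0\<close> together with \<open>\<bar>X\<^bsub>T1\<^esub>\<bar> < log_strike\<close>.\<close>
definition exercise_prob :: "real \<Rightarrow> real \<Rightarrow> real" where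
  "exercise_prob t x = Nd (bm_zscore \<mu> \<sigma> (T1 - t) x 0) - Nd (bm_zscore \<mu> \<sigma> (T1 - t) x log_strike)"

definition joint_prob :: "real \<Rightarrow> real \<Rightarrow> real" where
  "joint_prob t x = (let \<rho> = sqrt ((T1 - t) / (T - t)); d = bm_zscore \<mu> \<sigma> (T - t) x 0;
      z = bm_zscore \<mu> \<sigma> (T1 - t) x
    in N2 d (z 0) \<rho> - N2 d (z log_strike) \<rho>
      + (N2 d (- z 0) (- \<rho>) - N2 d (- z (- log_strike)) (- \<rho>)))"

lemma price_eq_subtract_image:
  assumes "V > 0"
  shows "price V t = exp (- r * (T1 - t)) *
    ((E - R * exp (- r * (T - T1))) * subtract_image \<gamma> (exercise_prob t) (log_dist V t)
      - (1 - R) * exp (- r * (T - T1)) * subtract_image \<gamma> (joint_prob t) (log_dist V t))"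
proof -
  define x where "x = log_dist V t"
  have x: "ln (V / barrier t) = x" "ln (barrier t / V) = - x"
    using assms barrier_pos[of t] by (simp_all add: x_def log_dist_def ln_div)
  have "ln (barrier T1 / K * (barrier t / V)) = ln (barrier T1 / K) + ln (barrier t / V)"
    using assms barrier_pos K_pos by (intro ln_mult_pos) auto
  also have "ln (barrier T1 / K) = - log_strike"
    using K_pos barrier_pos[of T1] by (simp add: log_strike_def log_dist_def ln_div)
  finally have image_strike: "ln (barrier T1 / K * (barrier t / V)) = - x - log_strike"
    by (simp only: x)
  have strike: "ln (V / K) + (r - q - \<sigma>\<^sup>2 / 2) * (T1 - t) = x - log_strike + \<mu> * (T1 - t)"
    "ln (K / V) + (r - q - 2 * a - \<sigma>\<^sup>2 / 2) * (T1 - t) = - x - - log_strike + \<mu> * (T1 - t)"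
    using assms K_pos by (simp_all add: x_def log_strike_def log_dist_eq ln_div \<mu>_def algebra_simps)
  have discount: "exp (- r * (T - t)) = exp (- r * (T1 - t)) * exp (- r * (T - T1))"
    by (simp add: exp_add[symmetric] algebra_simps)
  have level_zscore: "(y - c + \<mu> * \<tau>) / (\<sigma> * sqrt \<tau>) = bm_zscore \<mu> \<sigma> \<tau> y c"
    and barrier_zscore: "(y + \<mu> * \<tau>) / (\<sigma> * sqrt \<tau>) = bm_zscore \<mu> \<sigma> \<tau> y 0" for y c \<tau>
    by (simp_all add: bm_zscore_def)
  have image_strike_neg: "- (- x - log_strike) = x - - log_strike" by simp
  show ?thesis
    unfolding Pput_def Let_def Vb_def[of a b T, symmetric] image_strike image_strike_neg x strike
      \<gamma>_def[symmetric] \<mu>_def[symmetric] powr_\<gamma>_eq[OF assms] discount level_zscore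
    unfolding barrier_zscore x_def[symmetric] subtract_image_def exercise_prob_def
      joint_prob_def Let_def
    by (simp add: algebra_simps)
qed

lemma exercise_prob_eq_integral:
  assumes "t < T1"
  shows "exercise_prob t x = integral {0..log_strike} (bm_density \<mu> \<sigma> (T1 - t) x)"
  unfolding exercise_prob_def using \<sigma>_pos assms log_strike_nonneg by (intro Nd_bm_zscore_diff) auto

lemma joint_prob_eq_integral:
  assumes "t < T1"
  shows "joint_prob t x = integral {- log_strike..log_strike}
    (\<lambda>y. bm_density \<mu> \<sigma> (T1 - t) x y * Nd (bm_zscore \<mu> \<sigma> (T - T1) y 0))"
proof -
  define f where "f y = bm_density \<mu> \<sigma> (T1 - t) x y * Nd (bm_zscore \<mu> \<sigma> (T - T1) y 0)" for y
  have times: "0 < T1 - t" "T1 - t < T - t" "T - t - (T1 - t) = T - T1"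
    using assms T1_less_T by auto
  have "joint_prob t x = integral {- log_strike..0} f + integral {0..log_strike} f"
    unfolding joint_prob_def Let_def f_def
    using N2_bm_zscore_upper_diff[OF \<sigma>_pos times(1,2) log_strike_nonneg, of \<mu> x 0]
      N2_bm_zscore_lower_diff[OF \<sigma>_pos times(1,2), of "- log_strike" 0 \<mu> x 0] log_strike_nonneg
    by (simp add: times(3))
  also have "\<dots> = integral {- log_strike..log_strike} f"
    unfolding f_def using log_strike_nonneg \<sigma>_pos times(1)
    by (intro Henstock_Kurzweil_Integration.integral_combine integrable_continuous_real
        continuous_intros continuous_on_Nd_bm_zscore) auto
  finally show ?thesis
    by (simp only: f_def[abs_def])
qed

lemma integral_bm_density_payoff:
  assumes "\<tau> > 0"
  shows "integral {\<alpha>..\<beta>} (\<lambda>y. bm_density \<mu> \<sigma> \<tau> x y * payoff y)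
    = (E - R * exp (- r * (T - T1))) * integral {\<alpha>..\<beta>} (bm_density \<mu> \<sigma> \<tau> x)
      - (1 - R) * exp (- r * (T - T1)) * integral {\<alpha>..\<beta>} (\<lambda>y. bm_density \<mu> \<sigma> \<tau> x y * survival y)"
    (is "_ = ?A * _ - ?B * _")
proof -
  have "bm_density \<mu> \<sigma> \<tau> x y * payoff y
      = ?A * bm_density \<mu> \<sigma> \<tau> x y - ?B * (bm_density \<mu> \<sigma> \<tau> x y * survival y)" for y
    by (simp add: payoff_eq_survival algebra_simps)
  moreover have "((\<lambda>y. ?A * bm_density \<mu> \<sigma> \<tau> x y - ?B * (bm_density \<mu> \<sigma> \<tau> x y * survival y))
      has_integral ?A * integral {\<alpha>..\<beta>} (bm_density \<mu> \<sigma> \<tau> x)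
      - ?B * integral {\<alpha>..\<beta>} (\<lambda>y. bm_density \<mu> \<sigma> \<tau> x y * survival y)) {\<alpha>..\<beta>}"
    using assms \<sigma>_pos
    by (intro has_integral_diff has_integral_mult_right integrable_integral
        integrable_continuous_real continuous_intros continuous_on_survival)
  ultimately show ?thesis
    by (simp only: integral_unique)
qed

lemma price_eq_subtract_image_payoff:
  assumes "t < T1" "V > 0"
  shows "price V t = exp (- r * (T1 - t)) * subtract_image \<gamma>
    (\<lambda>x. integral {0..log_strike} (\<lambda>y. bm_density \<mu> \<sigma> (T1 - t) x y * payoff y)) (log_dist V t)"
proof -
  define J where "J f x = integral {0..log_strike} (\<lambda>y. bm_density \<mu> \<sigma> (T1 - t) x y * f y)" for f x
  have "subtract_image \<gamma> (joint_prob t) x = subtract_image \<gamma> (J survival) x" for x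
    unfolding joint_prob_eq_integral[OF assms(1), abs_def] J_def survival_def
    using assms \<sigma>_pos \<gamma>_eq log_strike_nonneg continuous_on_Nd_bm_zscore
    by (intro subtract_image_integral_symmetric) auto
  moreover have "J payoff x = (E - R * exp (- r * (T - T1))) * exercise_prob t x
      - (1 - R) * exp (- r * (T - T1)) * J survival x" for x
    using assms by (simp add: J_def integral_bm_density_payoff exercise_prob_eq_integral)
  ultimately have "price V t = exp (- r * (T1 - t)) * subtract_image \<gamma> (J payoff) (log_dist V t)"
    unfolding price_eq_subtract_image[OF assms(2)]
    by (simp only: subtract_image_def[of \<gamma> "exercise_prob t"] subtract_image_def[of \<gamma> "J _"])
      (simp add: algebra_simps)
  then show ?thesis
    by (simp only: J_def[abs_def])
qed

lemma price_at_barrier: "price (barrier t) t = 0"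
  using price_eq_subtract_image[OF barrier_pos, of t t] barrier_pos[of t]
  by (simp add: log_dist_def subtract_image_def)

lemma bm_density_log_dist:
  assumes "V > 0"
  shows "bm_density \<mu> \<sigma> (T1 - t) (log_dist V t) y
    = bm_density (r - q - \<sigma>\<^sup>2 / 2) \<sigma> (T1 - t) (ln V) (y + ln (barrier T1))"
proof -
  have "y - (log_dist V t + \<mu> * (T1 - t))
      = y + ln (barrier T1) - (ln V + (r - q - \<sigma>\<^sup>2 / 2) * (T1 - t))"
    using assms by (simp add: ln_barrier log_dist_eq \<mu>_def algebra_simps)
  then show ?thesis
    by (simp only: bm_density_def normal_density_def)
qed

lemma price_eq_log_integrals:
  assumes "t < T1" "V > 0"
  defines "p \<equiv> bm_density (r - q - \<sigma>\<^sup>2 / 2) \<sigma> (T1 - t) (ln V)"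
  shows "price V t
    = exp (- r * (T1 - t)) * integral {0..log_strike} (\<lambda>y. p (y + ln (barrier T1)) * payoff y)
    - exp (- r * (T1 - t)) *
        integral {0..log_strike} (\<lambda>y. p (- y + ln (barrier T1)) * (exp (- \<gamma> * y) * payoff y))"
proof -
  define x where "x = log_dist V t"
  have "exp (\<gamma> * x) * (bm_density \<mu> \<sigma> (T1 - t) (- x) y * payoff y)
      = bm_density \<mu> \<sigma> (T1 - t) x (- y) * (exp (- \<gamma> * y) * payoff y)" for y
    using bm_density_reflect[OF \<sigma>_pos _ \<gamma>_eq, of "T1 - t" x "- y"] assms(1) by simp
  then have "exp (\<gamma> * x) * integral {0..log_strike} (\<lambda>y. bm_density \<mu> \<sigma> (T1 - t) (- x) y * payoff y)
      = integral {0..log_strike} (\<lambda>y. bm_density \<mu> \<sigma> (T1 - t) x (- y) * (exp (- \<gamma> * y) * payoff y))"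
    by (simp only: Henstock_Kurzweil_Integration.integral_mult_right[symmetric])
  then show ?thesis
    unfolding price_eq_subtract_image_payoff[OF assms(1,2)] subtract_image_def x_def p_def
      bm_density_log_dist[OF assms(2)] by (simp only: right_diff_distrib)
qed

lemma price_black_scholes:
  assumes "t < T1" "V > 0"
  shows "black_scholes_at r q \<sigma> price V t"
proof -
  define p where "p V t = bm_density (r - q - \<sigma>\<^sup>2 / 2) \<sigma> (T1 - t) (ln V)" for V t
  define direct where "direct V t = exp (- r * (T1 - t)) *
    integral {0..log_strike} (\<lambda>y. p V t (y + ln (barrier T1)) * payoff y)" for V t
  define image where "image V t = exp (- r * (T1 - t)) *
    integral {0..log_strike} (\<lambda>y. p V t (- y + ln (barrier T1)) * (exp (- \<gamma> * y) * payoff y))" for V t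
  have "black_scholes_at r q \<sigma> direct V t" "black_scholes_at r q \<sigma> image V t"
    unfolding direct_def[abs_def] image_def[abs_def] p_def using assms \<sigma>_pos
    by (intro black_scholes_at_bm_density_integral continuous_on_payoff continuous_intros; simp)+
  then have equation: "black_scholes_at r q \<sigma> (\<lambda>V t. direct V t - image V t) V t"
    by (rule black_scholes_at_diff)
  have price: "direct V t - image V t = price V t" if "t < T1" "V > 0" for V t
    using price_eq_log_integrals[OF that] by (simp add: direct_def image_def p_def)
  have "\<forall>\<^sub>F s in nhds t. s \<in> {..<T1}" "\<forall>\<^sub>F v in nhds V. v \<in> {0<..}"
    using assms by (intro eventually_nhds_in_open; simp)+
  then have "\<forall>\<^sub>F s in nhds t. direct V s - image V s = price V s"
    "\<forall>\<^sub>F v in nhds V. direct v t - image v t = price v t"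
    using assms by (auto elim!: eventually_mono intro: price)
  with equation show ?thesis
    by (rule black_scholes_at_cong)
qed

end

locale knockout_put_strike = knockout_put +
  assumes bond_less_E: "\<And>V. \<lbrakk>barrier T1 < V; V < K\<rbrakk> \<Longrightarrow> bond V < E"
    and bond_ge_E: "\<And>V. \<lbrakk>barrier T1 < V; V \<ge> K\<rbrakk> \<Longrightarrow> bond V \<ge> E"
begin

lemma less_K_iff: "barrier T1 * exp y < K \<longleftrightarrow> y < log_strike"
proof -
  have "barrier T1 * exp log_strike = K"
    using barrier_pos[of T1] K_pos by (simp add: log_strike_def log_dist_def)
  then show ?thesis
    using barrier_pos[of T1] by (metis exp_less_cancel_iff mult_less_cancel_left_pos)
qed

lemma payoff_pos: "\<lbrakk>0 < y; y < log_strike\<rbrakk> \<Longrightarrow> payoff y > 0"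
  using bond_less_E[of "barrier T1 * exp y"] less_K_iff[of y] barrier_pos[of T1]
  by (simp add: payoff_def)

lemma payoff_nonpos: "\<lbrakk>0 < y; log_strike \<le> y\<rbrakk> \<Longrightarrow> payoff y \<le> 0"
  using bond_ge_E[of "barrier T1 * exp y"] less_K_iff[of y] barrier_pos[of T1]
  by (simp add: payoff_def)

lemma payoff_log_strike:
  assumes "log_strike > 0"
  shows "payoff log_strike = 0"
proof (rule antisym)
  show "payoff log_strike \<le> 0"
    using assms by (simp add: payoff_nonpos)
  have "(payoff \<longlongrightarrow> payoff log_strike) (at_left log_strike)"
    using continuous_on_payoff[of UNIV]
    by (simp add: continuous_on_def filterlim_at_split)
  moreover have "\<forall>\<^sub>F y in at_left log_strike. payoff y \<ge> 0"
    using eventually_at_left[OF assms] payoff_pos assms by (auto intro!: exI[of _ 0] less_imp_le)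
  ultimately show "0 \<le> payoff log_strike"
    by (rule tendsto_lowerbound) simp
qed

lemma truncated_payoff_eq_pos_part:
  assumes "x > 0"
  shows "indicator {0..log_strike} x * payoff x = pos_part (payoff x)"
  using assms payoff_pos[of x] payoff_nonpos[of x] payoff_log_strike
  by (cases x log_strike rule: linorder_cases) (auto simp: pos_part_def)

lemma price_terminal:
  assumes V: "V > barrier T1"
  shows "((\<lambda>(v, s). price v s) \<longlongrightarrow> pos_part (E - bond V))
    (at (V, T1) within {(v, s). 0 \<le> s \<and> s < T1 \<and> v > barrier s})" (is "(_ \<longlongrightarrow> _) ?F")
proof -
  define J where "J p x = integral {0..log_strike} (\<lambda>y. bm_density \<mu> \<sigma> (T1 - snd p) x y * payoff y)"
    for p :: "real \<times> real" and x
  define x where "x = log_dist V T1"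
  have V_pos: "V > 0" and x: "x > 0"
    using V barrier_pos[of T1] by (simp_all add: x_def log_dist_def)
  have domain: "\<forall>\<^sub>F p in ?F. snd p < T1 \<and> fst p > 0"
    by (rule eventually_at_filter[THEN iffD2])
      (auto intro!: always_eventually barrier_pos[THEN order.strict_trans])
  have log_dist: "((\<lambda>p. log_dist (fst p) (snd p)) \<longlongrightarrow> x) ?F"
    unfolding x_def using V_pos by (intro tendsto_log_dist) (auto intro!: tendsto_eq_intros)
  have time: "((\<lambda>p. T1 - snd p) \<longlongrightarrow> 0) ?F"
    by (auto intro!: tendsto_eq_intros)
  have J_tendsto: "((\<lambda>p. J p (g p)) \<longlongrightarrow> indicator {0..log_strike} z * payoff z) ?F"
    if "(g \<longlongrightarrow> z) ?F" "z \<in> {0, log_strike} \<Longrightarrow> payoff z = 0" for g z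
    unfolding J_def using \<sigma>_pos domain that time
    by (intro bm_density_Icc_integral_tendsto continuous_on_payoff) (auto elim: eventually_mono)
  have "((\<lambda>p. exp (- r * (T1 - snd p)) * subtract_image \<gamma> (J p) (log_dist (fst p) (snd p)))
      \<longlongrightarrow> exp (- r * 0) * (indicator {0..log_strike} x * payoff x
        - exp (\<gamma> * x) * (indicator {0..log_strike} (- x) * payoff (- x)))) ?F"
    unfolding subtract_image_def using x payoff_log_strike log_strike_nonneg
    by (intro tendsto_intros J_tendsto log_dist time) auto
  also have "exp (- r * 0) * (indicator {0..log_strike} x * payoff x
        - exp (\<gamma> * x) * (indicator {0..log_strike} (- x) * payoff (- x))) = pos_part (E - bond V)"
    using x truncated_payoff_eq_pos_part[OF x] payoff_log_dist[OF V_pos] by (simp add: x_def)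
  finally show ?thesis
  proof (rule Lim_transform_eventually)
    show "\<forall>\<^sub>F p in ?F. exp (- r * (T1 - snd p)) * subtract_image \<gamma> (J p) (log_dist (fst p) (snd p))
        = (case p of (v, s) \<Rightarrow> price v s)"
      using domain
      by eventually_elim (simp add: case_prod_beta price_eq_subtract_image_payoff J_def[abs_def])
  qed
qed

end

theorem theorem4:
  fixes r q a \<sigma> b R T T1 E K :: real
  assumes "\<sigma> > 0" and "b > 0" and "0 \<le> R" and "R < 1"
    and "0 < T1" and "T1 < T"
    and "exp (- r * (T - T1)) * R < E" and "E < exp (- r * (T - T1))"
    and "K \<ge> Vb a b T T1"
    and "\<And>V. Vb a b T T1 < V \<Longrightarrow> V < K \<Longrightarrow> Bbond r q a \<sigma> b R T V T1 < E"
    and "\<And>V. Vb a b T T1 < V \<Longrightarrow> V \<ge> K \<Longrightarrow> Bbond r q a \<sigma> b R T V T1 \<ge> E"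
  defines "P \<equiv> Pput r q a \<sigma> b R T T1 E K"
  shows
    "(\<forall>V t. 0 \<le> t \<and> t < T1 \<and> V > Vb a b T t \<longrightarrow>
        (\<exists>Pt PV PVV.
           ((\<lambda>s. P V s) has_real_derivative Pt) (at t) \<and>
           ((\<lambda>v. P v t) has_real_derivative PV) (at V) \<and>
           (\<forall>\<^sub>F v in nhds V. (\<lambda>w. P w t) differentiable (at v)) \<and>
           (deriv (\<lambda>w. P w t) has_real_derivative PVV) (at V) \<and>
           Pt + 1/2 * \<sigma>\<^sup>2 * V\<^sup>2 * PVV + (r - q) * V * PV - r * P V t = 0))
     \<and> (\<forall>t. 0 \<le> t \<and> t < T1 \<longrightarrow> P (Vb a b T t) t = 0)
     \<and> (\<forall>V. V > Vb a b T T1 \<longrightarrow>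
          ((\<lambda>(v, s). P v s) \<longlongrightarrow> pos_part (E - Bbond r q a \<sigma> b R T V T1))
            (at (V, T1) within {(v, s). 0 \<le> s \<and> s < T1 \<and> v > Vb a b T s}))"
proof -
  interpret knockout_put_strike r q a \<sigma> b R T T1 E K
    using assms by unfold_locales auto
  have "V > 0" if "V > Vb a b T t" for V t
    using that barrier_pos[of t] by simp
  then show ?thesis
    unfolding P_def
    using price_black_scholes[THEN black_scholes_at_imp_deriv] price_at_barrier price_terminal
    by blast
qed

end
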